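(* Let $G=(V_G,E_G)$ be a connected graph with $v(G)=k\ge 2$ vertices, and let $N_G$ be the number of copies of $G$ in the binomial random-connection model $G_H(\mathcal{X}_n)$ with connection probabilities $p_nH(X_i,X_j)$. Then the cumulants of $N_G$ satisfy $$|\kappa_j(N_G)|\le\frac{j^{j-1}}{a(G)^j}\sum_{r=k}^{1+(k-1)j}|\mathcal{C}(j,k,r)|\,n^r\,p_n^{d(j,k,r)},\qquad j\ge 2,$$ where $\mathcal{C}(j,k,r)$ is the set of all connected non-flat partitions of $[j]\times[k]$ having precisely $r$ blocks, and $$d(j,k,r):=\min\big\{e(\rho_G):\rho\in\mathcal{C}(j,k,r)\big\}.$$
   Context: Binomial random-connection model. $X_1,\dots,X_n$ are i.i.d. random points of $\mathbb{R}^d$ with common continuous (atomless) distribution $\mu$, $\mathcal{X}_n=\{X_1,\dots,X_n\}$, $H:\mathbb{R}^d\times\mathbb{R}^d\to[0,1]$ is a symmetric measurable function, and $p_n\in(0,1)$. Given $\mathcal{X}_n$, each pair $X_i,X_j$ ($i\ne j$) is connected by an edge (written $X_i\sim X_j$) independently with probability $p_nH(X_i,X_j)$; equivalently $X_i\sim X_j$ iff $Y_{i,j}\le p_nH(X_i,X_j)$, with $Y_{i,j}=Y_{j,i}$, $1\le i<j\le n$, i.i.d. uniform on $[0,1]$ and independent of $\mathcal{X}_n$. The resulting random graph is $G_H(\mathcal{X}_n)$. Subgraph count. $G$ is a simple graph with vertex set identified with $[k]=\{1,\dots,k\}$, $e(G)=|E_G|$, and $a(G)$ is the number of automorphisms of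 $G$. With $[n]^k_{\neq}:=\{\beta\in[n]^k:\beta(i)\ne\beta(j)\text{ for }i\ne j\}$, $$N_G:=\frac{1}{a(G)}\sum_{\beta\in[n]^k_{\neq}}\ \prod_{\{u,v\}\in E_G}\mathbf{1}_{\{X_{\beta(u)}\sim X_{\beta(v)}\}}.$$ Partitions. Let $\pi=\{\pi_1,\dots,\pi_j\}$ be the partition of $[j]\times[k]$ into rows $\pi_i=\{(i,\ell):1\le\ell\le k\}$. A partition $\rho$ of $[j]\times[k]$ is non-flat if $\rho\wedge\pi$ is the partition into singletons (no block contains two elements of the same row), and connected if $\rho\vee\pi$ is the one-block partition, where $\wedge$ (resp. $\vee$) is the coarsest partition finer than (resp. finest partition coarser than) both. For a non-flat $\rho$, $\rho_G$ is the simple graph whose vertices are the blocks of $\rho$, with a (single) edge between distinct blocks $\rho_1,\rho_2$ if and only if there exist $i\in[j]$ and $(i,l_1)\in\rho_1$, $(i,l_2)\in\rho_2$ with $\{l_1,l_2\}\in E_G$; $e(\rho_G)$ is its number of edges. $\kappa_j$ denotes the $j$-th cumulant. *)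

theory Defs
  imports
    "HOL-Probability.Probability"
    "HOL-Combinatorics.Permutations"
    "HOL-Library.Disjoint_Sets"
begin

section \<open>Simple graphs on a finite vertex set\<close>

definition simple_graph :: "'v set \<Rightarrow> 'v set set \<Rightarrow> bool" where
  "simple_graph V E \<longleftrightarrow> finite V \<and> (\<forall>e\<in>E. e \<subseteq> V \<and> card e = 2)"

definition connected_graph :: "'v set \<Rightarrow> 'v set set \<Rightarrow> bool" where
  "connected_graph V E \<longleftrightarrow>
     simple_graph V E \<and> V \<noteq> {} \<and> (\<forall>u\<in>V. \<forall>v\<in>V. (u, v) \<in> {(x, y). {x, y} \<in> E}\<^sup>*)"

definition automorphisms :: "'v set \<Rightarrow> 'v set set \<Rightarrow> ('v \<Rightarrow> 'v) set" where
  "automorphisms V E =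
     {\<sigma>. \<sigma> permutes V \<and> (\<forall>u\<in>V. \<forall>v\<in>V. {\<sigma> u, \<sigma> v} \<in> E \<longleftrightarrow> {u, v} \<in> E)}"


section \<open>The binomial random-connection model\<close>

text \<open>
  The uniform variable attached to the unordered pair of indices \<open>i \<noteq> j\<close> is
  \<open>Y (i, j)\<close> with \<open>i < j\<close>; only these index pairs are used.
\<close>

definition index_pairs :: "nat \<Rightarrow> (nat \<times> nat) set" where
  "index_pairs n = {(i, j). 1 \<le> i \<and> i < j \<and> j \<le> n}"

locale binomial_rcm = prob_space M
  for M :: "'w measure" +
  fixes n :: nat
    and \<mu> :: "(real ^ 'd) measure"
    and H :: "real ^ 'd \<Rightarrow> real ^ 'd \<Rightarrow> real"
    and p :: real
    and X :: "nat \<Rightarrow> 'w \<Rightarrow> real ^ 'd"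
    and Y :: "nat \<times> nat \<Rightarrow> 'w \<Rightarrow> real"
  assumes prob_space_mu: "prob_space \<mu>"
    and sets_mu: "sets \<mu> = sets borel"
    and atomless_mu: "\<And>x. measure \<mu> {x} = 0"
    and H_measurable: "(\<lambda>(x, y). H x y) \<in> borel_measurable (borel \<Otimes>\<^sub>M borel)"
    and H_sym: "\<And>x y. H x y = H y x"
    and H_range: "\<And>x y. 0 \<le> H x y \<and> H x y \<le> 1"
    and p_range: "0 < p" "p < 1"
    and X_distr: "\<And>i. i \<in> {1..n} \<Longrightarrow> distr M borel (X i) = \<mu>"
    and X_indep: "indep_vars (\<lambda>_. borel) X {1..n}"
    and Y_distr: "\<And>e. e \<in> index_pairs n \<Longrightarrow> distr M borel (Y e) = uniform_measure lborel {0..1}"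
    and Y_indep: "indep_vars (\<lambda>_. borel) Y (index_pairs n)"
    and XY_indep: "indep_set
          (sigma_sets (space M) {X i -` A \<inter> space M | i A. i \<in> {1..n} \<and> A \<in> sets borel})
          (sigma_sets (space M) {Y e -` B \<inter> space M | e B. e \<in> index_pairs n \<and> B \<in> sets borel})"

text \<open>Edge set of the random graph; its vertices are the indices \<open>i\<close> of the points \<open>X i\<close>.\<close>

definition rcm_edges ::
  "nat \<Rightarrow> ('x \<Rightarrow> 'x \<Rightarrow> real) \<Rightarrow> real \<Rightarrow> (nat \<Rightarrow> 'w \<Rightarrow> 'x) \<Rightarrow> (nat \<times> nat \<Rightarrow> 'w \<Rightarrow> real) \<Rightarrow> 'w \<Rightarrow> nat set set"
  where
  "rcm_edges n H p X Y \<omega> =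
     {{i, j} | i j. (i, j) \<in> index_pairs n \<and> Y (i, j) \<omega> \<le> p * H (X i \<omega>) (X j \<omega>)}"

text \<open>
  Number of copies of the graph \<open>({1..k}, E)\<close> in the graph \<open>({1..n}, F)\<close>. For an edge
  \<open>e = {u, v}\<close> the image \<open>\<beta> ` e\<close> is \<open>{\<beta> u, \<beta> v}\<close>.
\<close>

definition copies :: "nat \<Rightarrow> nat set set \<Rightarrow> nat \<Rightarrow> nat set set \<Rightarrow> real" where
  "copies k E n F =
     (1 / real (card (automorphisms {1..k} E))) *
     (\<Sum>\<beta> \<in> {\<beta> \<in> {1..k} \<rightarrow>\<^sub>E {1..n}. inj_on \<beta> {1..k}}. \<Prod>e\<in>E. of_bool (\<beta> ` e \<in> F))"

text \<open>
  The \<open>j\<close>-th Taylor coefficient (times \<open>j!\<close>) at \<open>0\<close> of the cumulant generating function. It is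
  meaningful when the moment generating function is finite near \<open>0\<close>, in particular for bounded
  random variables.
\<close>

definition cumulant :: "'w measure \<Rightarrow> nat \<Rightarrow> ('w \<Rightarrow> real) \<Rightarrow> real" where
  "cumulant M j Z = (deriv ^^ j) (\<lambda>t. ln (LINT \<omega>|M. exp (t * Z \<omega>))) 0"


section \<open>Partitions\<close>

text \<open>
  The meet of two partitions is the library's \<^const>\<open>common_refinement\<close>, see
  \<open>refines_common_refinement\<close> and \<open>common_refinement_coarsest\<close>.
\<close>

definition is_partition_join :: "'a set \<Rightarrow> 'a set set \<Rightarrow> 'a set set \<Rightarrow> 'a set set \<Rightarrow> bool" where
  "is_partition_join A P Q R \<longleftrightarrow>
     refines A P R \<and> refines A Q R \<and> (\<forall>S. refines A P S \<and> refines A Q S \<longrightarrow> refines A R S)"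

definition partition_join :: "'a set \<Rightarrow> 'a set set \<Rightarrow> 'a set set \<Rightarrow> 'a set set" where
  "partition_join A P Q = (THE R. is_partition_join A P Q R)"

lemma is_partition_join_partition_join:
  assumes "partition_on A P" "partition_on A Q"
  shows "is_partition_join A P Q (partition_join A P Q)"
proof -
  let ?U = "{S. refines A P S \<and> refines A Q S}"
  let ?R = "common_refinement ?U"
  have "refines A T ({A} - {{}})" if "partition_on A T" for T
    using that by (auto simp: refines_def partition_on_def disjoint_def)
  with assms have ne: "?U \<noteq> {}" by blast
  have part: "partition_on A S" if "S \<in> ?U" for S
    using that by (simp add: refines_def)
  have "refines A P ?R"
    by (rule common_refinement_coarsest[OF part assms(1) _ ne]) simp_all
  moreover have "refines A Q ?R"
    by (rule common_refinement_coarsest[OF part assms(2) _ ne]) simp_all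
  moreover have "refines A ?R S" if "refines A P S" "refines A Q S" for S
    by (rule refines_common_refinement[OF part]) (use that in simp_all)
  ultimately have R: "is_partition_join A P Q ?R"
    unfolding is_partition_join_def by simp
  moreover have "R' = ?R" if "is_partition_join A P Q R'" for R'
    using that R unfolding is_partition_join_def by (intro refines_asym[of A]) simp_all
  ultimately show ?thesis
    unfolding partition_join_def by (rule theI)
qed

definition grid :: "nat \<Rightarrow> nat \<Rightarrow> (nat \<times> nat) set" where
  "grid j k = {1..j} \<times> {1..k}"

definition rows :: "nat \<Rightarrow> nat \<Rightarrow> (nat \<times> nat) set set" where
  "rows j k = (\<lambda>i. {i} \<times> {1..k}) ` {1..j}"

definition non_flat :: "nat \<Rightarrow> nat \<Rightarrow> (nat \<times> nat) set set \<Rightarrow> bool" where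
  "non_flat j k \<rho> \<longleftrightarrow> common_refinement {\<rho>, rows j k} = (\<lambda>x. {x}) ` grid j k"

definition connected_partition :: "nat \<Rightarrow> nat \<Rightarrow> (nat \<times> nat) set set \<Rightarrow> bool" where
  "connected_partition j k \<rho> \<longleftrightarrow> partition_join (grid j k) \<rho> (rows j k) = {grid j k}"

definition conn_nonflat :: "nat \<Rightarrow> nat \<Rightarrow> nat \<Rightarrow> (nat \<times> nat) set set set" where
  "conn_nonflat j k r =
     {\<rho>. partition_on (grid j k) \<rho> \<and> non_flat j k \<rho> \<and> connected_partition j k \<rho> \<and> card \<rho> = r}"

text \<open>Edge set of \<open>\<rho>\<^sub>G\<close>, whose vertices are the blocks of \<open>\<rho>\<close>.\<close>

definition quotient_edges ::
  "nat \<Rightarrow> nat set set \<Rightarrow> (nat \<times> nat) set set \<Rightarrow> (nat \<times> nat) set set set" where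
  "quotient_edges j E \<rho> =
     {{B, C} | B C. B \<in> \<rho> \<and> C \<in> \<rho> \<and> B \<noteq> C \<and>
        (\<exists>i\<in>{1..j}. \<exists>l m. (i, l) \<in> B \<and> (i, m) \<in> C \<and> {l, m} \<in> E)}"

text \<open>
  Unspecified when \<open>conn_nonflat j k r\<close> is empty; in the cumulant bound it is then multiplied
  by the cardinality \<open>0\<close>.
\<close>

definition min_edges :: "nat set set \<Rightarrow> nat \<Rightarrow> nat \<Rightarrow> nat \<Rightarrow> nat" where
  "min_edges E j k r = Min ((\<lambda>\<rho>. card (quotient_edges j E \<rho>)) ` conn_nonflat j k r)"

end

theory Submission
  imports Defs
begin

text \<open>
  Write \<open>N\<^sub>G\<close> as a sum over injections \<open>\<beta>\<close> of \<open>1/a(G)\<close> times the indicator that all edges of \<open>\<beta>(G)\<close>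
  are present. By multilinearity, \<open>\<kappa>\<^sub>j(N\<^sub>G)\<close> is the sum of the joint cumulants of all \<open>j\<close>-tuples of
  such terms. Conditionally on the points the edges are independent, so a set \<open>D\<close> of edges is present
  with probability at most \<open>p\<close> to the power \<open>|D|\<close>, and vertex-disjoint sets of edges are independent.
  Hence the joint cumulant of a tuple vanishes unless its images are linked through common vertices,
  and the recursion for joint cumulants bounds it by \<open>j^(j-1)/a(G)^j\<close> times \<open>p\<close> to the number of distinct
  edges in the union of the images. A linked tuple induces a connected non-flat partition \<open>\<rho>\<close> of
  the grid (cells with equal image form a block), it uses at least \<open>e(\<rho>\<^sub>G)\<close> edges, and at most
  \<open>n^r\<close> tuples induce a given partition with \<open>r\<close> blocks.
\<close>

section \<open>Joint cumulants\<close>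

lemma sum_Pow_card:
  fixes g :: "nat \<Rightarrow> real"
  assumes "finite A"
  shows "(\<Sum>U\<in>Pow A. g (card U)) = (\<Sum>i\<le>card A. real (card A choose i) * g i)"
proof -
  have "(\<Sum>U\<in>Pow A. g (card U)) = (\<Sum>i\<le>card A. \<Sum>U | U \<in> Pow A \<and> card U = i. g (card U))"
    using assms by (intro sum.group [symmetric]) (auto intro: card_mono)
  also have "\<dots> = (\<Sum>i\<le>card A. real (card A choose i) * g i)"
    using n_subsets[OF assms] by (intro sum.cong) auto
  finally show ?thesis .
qed

lemma finite_psubsets: "finite A \<Longrightarrow> finite {U. U \<subset> A}"
  by (rule finite_subset[of _ "Pow A"]) auto

text \<open>
  The moment-cumulant relation solved for the top cumulant: \<open>m T\<close> is the moment of the subfamily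
  \<open>T\<close>, and \<open>insert (Min S) U\<close> is the block containing the index \<open>Min S\<close>.
\<close>

function joint_cumulant :: "('a :: linorder set \<Rightarrow> real) \<Rightarrow> 'a set \<Rightarrow> real" where
  "joint_cumulant m S =
     (if finite S \<and> S \<noteq> {}
      then m S - (\<Sum>U | U \<subset> S - {Min S}. joint_cumulant m (insert (Min S) U) * m (S - insert (Min S) U))
      else 0)"
  by pat_completeness auto
termination
proof (relation "Wellfounded.measure (\<lambda>(m, S). card S)")
  fix m :: "'a set \<Rightarrow> real" and S U :: "'a set"
  assume S: "finite S \<and> S \<noteq> {}" and U: "U \<in> {U. U \<subset> S - {Min S}}"
  then have "insert (Min S) U \<subset> S"
    using Min_in[of S] by blast
  with S show "((m, insert (Min S) U), m, S) \<in> Wellfounded.measure (\<lambda>(m, S). card S)"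
    by (simp add: psubset_card_mono)
qed simp

declare joint_cumulant.simps [simp del]

text \<open>The recursion with its omitted term \<open>U = S - {Min S}\<close> restored; that term
  is \<open>joint_cumulant m S\<close> times \<open>m {}\<close>, hence the normalisation
  \<open>m {} = 1\<close>.\<close>

lemma moment_joint_cumulant:
  assumes "finite S" "S \<noteq> {}" "m {} = 1"
  shows "m S = (\<Sum>U\<in>Pow (S - {Min S}). joint_cumulant m (insert (Min S) U) * m (S - insert (Min S) U))"
proof -
  let ?A = "S - {Min S}"
  have Pow_A: "Pow ?A = insert ?A {U. U \<subset> ?A}" by auto
  have ins: "insert (Min S) ?A = S"
    using Min_in[OF assms(1,2)] by blast
  show ?thesis
    unfolding Pow_A using assms
    by (subst sum.insert)
      (simp_all add: ins joint_cumulant.simps[of m S] finite_psubsets del: insert_Diff_single)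
qed

text \<open>The recursion evaluates \<open>m\<close> on subsets of \<open>S\<close> only. This
  allows a tuple to be restricted to the block under consideration in
  \<open>cumulant_sum\<close>.\<close>

lemma joint_cumulant_cong:
  assumes "\<And>T. T \<subseteq> S \<Longrightarrow> m T = m' T"
  shows "joint_cumulant m S = joint_cumulant m' S"
proof (cases "finite S")
  case True
  then show ?thesis using assms
  proof (induction S rule: finite_psubset_induct)
    case (psubset S)
    show ?case
    proof (cases "S = {}")
      case False
      have "joint_cumulant m (insert (Min S) U) = joint_cumulant m' (insert (Min S) U)"
        if "U \<subset> S - {Min S}" for U
      proof (rule psubset.IH)
        show sub: "insert (Min S) U \<subset> S"
          using that Min_in[OF psubset.hyps(1) False] by auto
        show "m T = m' T" if "T \<subseteq> insert (Min S) U" for T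
          using psubset.prems sub that by auto
      qed
      then show ?thesis
        using psubset.prems by (auto simp: joint_cumulant.simps[of _ S] intro!: sum.cong)
    qed (simp add: joint_cumulant.simps)
  qed
qed (simp add: joint_cumulant.simps)

text \<open>Independence of the two parts makes the recursion collapse. With \<open>Min S\<close> in
  \<open>A\<close>, a block reaching into \<open>B\<close> is itself split, so its cumulant is 0 by
  induction. In the remaining terms \<open>m B\<close> factors out and the moment relation on
  \<open>A\<close> sums the rest to \<open>m A\<close>; the total \<open>m A * m B\<close> cancels
  \<open>m S\<close>.\<close>

lemma joint_cumulant_eq_0:
  assumes "finite S" "m {} = 1"
    and "A \<union> B = S" "A \<inter> B = {}" "A \<noteq> {}" "B \<noteq> {}"
    and "\<And>T. T \<subseteq> S \<Longrightarrow> m T = m (T \<inter> A) * m (T \<inter> B)"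
  shows "joint_cumulant m S = 0"
  using assms
proof (induction S arbitrary: A B rule: finite_psubset_induct)
  case (psubset S)
  have *: "joint_cumulant m S = 0"
    if AB: "A \<union> B = S" "A \<inter> B = {}" "B \<noteq> {}" and s: "Min S \<in> A"
      and fac: "\<And>T. T \<subseteq> S \<Longrightarrow> m T = m (T \<inter> A) * m (T \<inter> B)" for A B
  proof -
    define s where "s = Min S"
    have sA: "s \<in> A" using s s_def by simp
    have ne: "S \<noteq> {}" and fA: "finite A"
      using AB psubset.hyps s by auto
    \<comment> \<open>The recursions for \<open>A\<close> and for \<open>S\<close> thus single out
      the same element, which is what allows the moment relation on \<open>A\<close> to be used
      below.\<close>
    have "Min A = s"
      unfolding s_def using AB psubset.hyps s by (intro Min_eqI) auto
    let ?f = "\<lambda>U. joint_cumulant m (insert s U) * m (S - insert s U)"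
    have zero: "?f U = 0" if U: "U \<in> {U. U \<subset> S - {s}} - Pow (A - {s})" for U
    proof -
      have sub: "insert s U \<subset> S" using U sA AB by auto
      have "joint_cumulant m (insert s U) = 0"
      proof (rule psubset.IH[OF sub, of "insert s U \<inter> A" "insert s U \<inter> B"])
        show "m T = m (T \<inter> (insert s U \<inter> A)) * m (T \<inter> (insert s U \<inter> B))" if T: "T \<subseteq> insert s U" for T
        proof -
          have "T \<inter> (insert s U \<inter> A) = T \<inter> A" "T \<inter> (insert s U \<inter> B) = T \<inter> B"
            using T by auto
          then show ?thesis using fac[of T] T sub by auto
        qed
      qed (use U sA AB psubset.prems(1) in auto)
      then show ?thesis by simp
    qed
    \<comment> \<open>Since \<open>B\<close> is nonempty, even \<open>U = A - {s}\<close> is proper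
      in \<open>S - {s}\<close>, so the complete sum for \<open>A\<close> occurs, top term
      included.\<close>
    have psub: "Pow (A - {s}) \<subseteq> {U. U \<subset> S - {s}}"
      using AB sA by auto
    have "(\<Sum>U | U \<subset> S - {s}. ?f U) = (\<Sum>U\<in>Pow (A - {s}). ?f U)"
      using zero psub psubset.hyps by (intro sum.mono_neutral_right) (auto intro!: finite_psubsets)
    also have "\<dots> = (\<Sum>U\<in>Pow (A - {s}). joint_cumulant m (insert s U) * m (A - insert s U)) * m B"
      unfolding sum_distrib_right
    proof (rule sum.cong)
      fix U assume U: "U \<in> Pow (A - {s})"
      have "(S - insert s U) \<inter> A = A - insert s U" "(S - insert s U) \<inter> B = B"
        using U AB sA by auto
      then show "?f U = joint_cumulant m (insert s U) * m (A - insert s U) * m B"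
        using fac[of "S - insert s U"] by auto
    qed simp
    also have "\<dots> = m A * m B"
    proof -
      have "A \<noteq> {}" using sA by auto
      then show ?thesis
        using moment_joint_cumulant[of A m] fA psubset.prems(1) by (simp add: \<open>Min A = s\<close>)
    qed
    also have "\<dots> = m S"
      using fac[of S] AB by (metis Int_absorb1 Un_upper1 Un_upper2 order_refl)
    finally show ?thesis
      using ne psubset.hyps by (simp add: joint_cumulant.simps[of m S] s_def)
  qed
  have "Min S \<in> S"
    using psubset.prems(2,4) psubset.hyps by (intro Min_in) auto
  then consider "Min S \<in> A" | "Min S \<in> B"
    using psubset.prems(2) by auto
  then show ?case
  proof cases
    case 1
    then show ?thesis by (intro *[of A B] psubset.prems)
  next
    case 2
    then show ?thesis
    proof (intro *[of B A])
      show "m T = m (T \<inter> B) * m (T \<inter> A)" if "T \<subseteq> S" for T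
        using psubset.prems(6)[OF that] by (simp add: mult.commute)
    qed (use psubset.prems(2-5) in auto)
  qed
qed

text \<open>The weight \<open>w\<close> is supermultiplicative over disjoint parts, so every product
  in the recursion is at most a constant times \<open>w S\<close>, and only the constants have to be
  summed. Later \<open>w\<close> is a power of \<open>p\<close> counting distinct edges, times a
  power of \<open>1/a(G)\<close>.\<close>

lemma abs_joint_cumulant_le:
  assumes "finite S" "S \<noteq> {}"
    and "\<And>T. T \<subseteq> S \<Longrightarrow> \<bar>m T\<bar> \<le> w T"
    and "\<And>T R. T \<subseteq> R \<Longrightarrow> R \<subseteq> S \<Longrightarrow> w T * w (R - T) \<le> w R"
  shows "\<bar>joint_cumulant m S\<bar> \<le> real (card S) ^ (card S - 1) * w S"
  using assms
proof (induction S rule: finite_psubset_induct)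
  case (psubset S)
  define s where "s = Min S"
  define A where "A = S - {s}"
  define N where "N = card A"
  have s: "s \<in> S" using psubset.hyps psubset.prems s_def by simp
  have fA: "finite A" using psubset.hyps A_def by simp
  have cS: "card S = Suc N"
    using s psubset.hyps by (simp add: N_def A_def card_Suc_Diff1 del: card_Diff_insert)
  have w0: "0 \<le> w T" if "T \<subseteq> S" for T
    using psubset.prems(2)[OF that] by linarith
  have term_le: "\<bar>joint_cumulant m (insert s U) * m (S - insert s U)\<bar> \<le> real N ^ card U * w S"
    if U: "U \<subset> A" for U
  proof -
    have sub: "insert s U \<subset> S" and sU: "s \<notin> U" and fU: "finite U"
      using U s fA by (auto simp: A_def intro: finite_subset)
    have "card U < N"
      using U fA N_def by (simp add: psubset_card_mono)
    have "\<bar>joint_cumulant m (insert s U)\<bar>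
        \<le> real (card (insert s U)) ^ (card (insert s U) - 1) * w (insert s U)"
    proof (rule psubset.IH[OF sub])
      show "\<bar>m T\<bar> \<le> w T" if "T \<subseteq> insert s U" for T
        using psubset.prems(2) that sub by auto
      show "w T * w (R - T) \<le> w R" if "T \<subseteq> R" "R \<subseteq> insert s U" for T R
        using psubset.prems(3) that sub by auto
    qed simp
    also have "\<dots> = real (Suc (card U)) ^ card U * w (insert s U)"
      using sU fU by simp
    also have "\<dots> \<le> real N ^ card U * w (insert s U)"
      using \<open>card U < N\<close> sub by (intro mult_right_mono power_mono w0) auto
    finally have "\<bar>joint_cumulant m (insert s U) * m (S - insert s U)\<bar>
        \<le> real N ^ card U * w (insert s U) * w (S - insert s U)"
      unfolding abs_mult using sub by (intro mult_mono psubset.prems(2) mult_nonneg_nonneg w0) auto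
    also have "\<dots> \<le> real N ^ card U * w S"
      unfolding mult.assoc using psubset.prems(3)[of "insert s U" S] sub
      by (intro mult_left_mono) (simp_all add: psubset_eq)
    finally show ?thesis .
  qed
  have Pow_A: "Pow A = insert A {U. U \<subset> A}" by auto
  \<comment> \<open>Replacing \<open>(card U + 1) ^ card U\<close> by \<open>N ^ card U\<close> turns the recursive bound into a
    binomial sum, and dropping its top term \<open>N ^ N\<close> makes room for the term \<open>m S\<close>.\<close>
  have "(\<Sum>U\<in>Pow A. real N ^ card U) = (real N + 1) ^ N"
    using fA by (simp add: sum_Pow_card binomial_ring N_def)
  then have sum_eq: "(\<Sum>U | U \<subset> A. real N ^ card U) = (real N + 1) ^ N - real N ^ N"
    using fA by (subst (asm) Pow_A, subst (asm) sum.insert)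
      (auto simp: N_def finite_psubsets)
  have "\<bar>joint_cumulant m S\<bar>
      \<le> \<bar>m S\<bar> + \<bar>\<Sum>U | U \<subset> A. joint_cumulant m (insert s U) * m (S - insert s U)\<bar>"
    using psubset.hyps psubset.prems(1)
    by (simp add: joint_cumulant.simps[of m S] s_def A_def abs_triangle_ineq4)
  also have "\<dots> \<le> w S + (\<Sum>U | U \<subset> A. real N ^ card U * w S)"
    using term_le psubset.prems(2) by (intro add_mono order.trans[OF sum_abs] sum_mono) auto
  also have "\<dots> = (1 + (real N + 1) ^ N - real N ^ N) * w S"
    by (simp add: sum_eq distrib_right left_diff_distrib flip: sum_distrib_right)
  also have "\<dots> \<le> (real N + 1) ^ N * w S"
  proof (rule mult_right_mono)
    \<comment> \<open>The case \<open>N = 0\<close>, that of a singleton \<open>S\<close>, relies on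
      \<open>0 ^ 0 = 1\<close>.\<close>
    have "1 \<le> real N ^ N" by (cases "N = 0") (auto intro: one_le_power)
    then show "1 + (real N + 1) ^ N - real N ^ N \<le> (real N + 1) ^ N" by simp
  qed (simp add: w0)
  finally show ?case by (simp add: cS add.commute)
qed

section \<open>Moments and cumulants of a variable with finite range\<close>

text \<open>This is the Leibniz rule applied to \<open>F 1 = (ln F 0)' * F 0\<close>, where
  \<open>F i\<close> is the \<open>i\<close>-th derivative of \<open>F 0\<close>. As
  \<open>deriv\<close> has a value even where no derivative exists, differentiability of each
  iterate must be established as well.\<close>

lemma higher_deriv_ln_recurrence:
  fixes F :: "nat \<Rightarrow> real \<Rightarrow> real"
  assumes dF: "\<And>i t. (F i has_real_derivative F (Suc i) t) (at t)"
    and pos: "\<And>t. F 0 t > 0"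
  shows "F (Suc s) t =
    (\<Sum>i\<le>s. real (s choose i) * (deriv ^^ Suc i) (\<lambda>t. ln (F 0 t)) t * F (s - i) t)"
proof -
  define L where "L i = (deriv ^^ i) (\<lambda>t. ln (F 0 t))" for i
  have L0: "L 0 = (\<lambda>t. ln (F 0 t))" and LSuc: "L (Suc i) = deriv (L i)" for i
    by (simp_all add: L_def)
  \<comment> \<open>The two claims feed each other: the identity for \<open>r\<close>, solved for
    its top term, shows that \<open>L (Suc r)\<close> is differentiable, and then the identity can
    be differentiated once more.\<close>
  have "(\<forall>t. (L s has_real_derivative L (Suc s) t) (at t)) \<and>
    (\<forall>t. F (Suc s) t = (\<Sum>i\<le>s. real (s choose i) * L (Suc i) t * F (s - i) t))" for s
  proof (induction s rule: less_induct)
    case (less s)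
    show ?case
    proof (cases s)
      case 0
      have "(L 0 has_real_derivative F 1 t / F 0 t) (at t)" for t
        unfolding L0 using pos[of t] by (auto intro!: derivative_eq_intros dF[of 0])
      moreover from this have "L 1 t = F 1 t / F 0 t" for t
        by (simp add: LSuc DERIV_imp_deriv)
      ultimately show ?thesis
        using 0 less_imp_neq[OF pos] by auto
    next
      case (Suc r)
      have d: "(L i has_real_derivative L (Suc i) t) (at t)" if "i \<le> r" for i t
        using less Suc that by auto
      have id: "F (Suc r) t = (\<Sum>i\<le>r. real (r choose i) * L (Suc i) t * F (r - i) t)" for t
        using less Suc by auto
      \<comment> \<open>The term \<open>i = r\<close> has coefficient 1 and the positive factor
        \<open>F 0 t\<close>, so it can be isolated.\<close>
      have solve: "L (Suc r) = (\<lambda>t. (F (Suc r) t -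
          (\<Sum>i<r. real (r choose i) * L (Suc i) t * F (r - i) t)) / F 0 t)"
      proof
        fix t
        show "L (Suc r) t = (F (Suc r) t -
          (\<Sum>i<r. real (r choose i) * L (Suc i) t * F (r - i) t)) / F 0 t"
          using id[of t] pos[of t] by (simp add: field_simps flip: lessThan_Suc_atMost)
      qed
      have diff: "F i field_differentiable at t" "i < r \<Longrightarrow> L (Suc i) field_differentiable at t" for i t
        using dF[of i t] d[of "Suc i" t] unfolding field_differentiable_def by auto
      have "(\<lambda>t. (F (Suc r) t - (\<Sum>i<r. real (r choose i) * L (Suc i) t * F (r - i) t)) / F 0 t)
          field_differentiable at t" for t
        using pos[of t]
        by (intro field_differentiable_divide field_differentiable_diff field_differentiable_sum
              field_differentiable_mult field_differentiable_const diff) auto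
      then have "L (Suc r) field_differentiable at t" for t
        using solve by simp
      then have dr: "(L (Suc r) has_real_derivative L (Suc (Suc r)) t) (at t)" for t
        unfolding LSuc[of "Suc r"] by (rule field_differentiable_derivI)
      have d': "(L (Suc i) has_real_derivative L (Suc (Suc i)) t) (at t)" if "i \<le> r" for i t
        using d[of "Suc i"] dr that by (cases "i = r") auto
      have "F (Suc (Suc r)) t = (\<Sum>i\<le>Suc r. real (Suc r choose i) * L (Suc i) t * F (Suc r - i) t)" for t
      proof -
        define a where "a i b = L (Suc i) t * F b t" for i b
        have "((\<lambda>t. \<Sum>i\<le>r. real (r choose i) * L (Suc i) t * F (r - i) t) has_real_derivative
            (\<Sum>i\<le>r. real (r choose i) * (a (Suc i) (r - i) + a i (Suc r - i)))) (at t)"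
          by (auto intro!: derivative_eq_intros d' dF sum.cong simp: a_def Suc_diff_le algebra_simps)
        then have "F (Suc (Suc r)) t = (\<Sum>i\<le>r. real (r choose i) * (a (Suc i) (r - i) + a i (Suc r - i)))"
          using dF[of "Suc r" t] DERIV_unique unfolding id[abs_def] by blast
        \<comment> \<open>The second sum is extended to \<open>Suc r\<close>, where the binomial
          coefficient is 0; after a shift of the first sum, Pascal's rule merges both.\<close>
        also have "\<dots> = (\<Sum>i\<le>r. real (r choose i) * a (Suc i) (r - i)) +
            (\<Sum>i\<le>Suc r. real (r choose i) * a i (Suc r - i))"
          by (simp add: sum.distrib distrib_left)
        also have "\<dots> = (\<Sum>i\<le>Suc r. real (Suc r choose i) * a i (Suc r - i))"
          by (simp add: sum.atMost_Suc_shift sum.distrib algebra_simps del: sum.atMost_Suc)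
        finally show ?thesis by (simp add: a_def mult.assoc)
      qed
      with dr Suc show ?thesis by auto
    qed
  qed
  then show ?thesis by (simp add: L_def)
qed

context prob_space
begin

text \<open>Turns expectations into finite sums, so that differentiating under the expectation
  becomes termwise differentiation.\<close>

lemma expectation_finite_range:
  fixes Z :: "'a \<Rightarrow> real" and g :: "real \<Rightarrow> real"
  assumes [measurable]: "Z \<in> borel_measurable M" and "finite (Z ` space M)"
  shows "expectation (\<lambda>\<omega>. g (Z \<omega>)) = (\<Sum>z\<in>Z ` space M. g z * prob {\<omega> \<in> space M. Z \<omega> = z})"
proof -
  have "expectation (\<lambda>\<omega>. g (Z \<omega>)) =
      expectation (\<lambda>\<omega>. \<Sum>z\<in>Z ` space M. g z * indicator {\<omega> \<in> space M. Z \<omega> = z} \<omega>)"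
  proof (rule Bochner_Integration.integral_cong)
    fix \<omega> assume "\<omega> \<in> space M"
    then show "g (Z \<omega>) = (\<Sum>z\<in>Z ` space M. g z * indicator {\<omega> \<in> space M. Z \<omega> = z} \<omega>)"
      using assms(2) by (subst sum.remove[of _ "Z \<omega>"]) (auto simp: indicator_def intro!: sum.neutral)
  qed simp
  also have "\<dots> = (\<Sum>z\<in>Z ` space M. g z * prob {\<omega> \<in> space M. Z \<omega> = z})"
    by (subst Bochner_Integration.integral_sum) (auto intro!: integrable_real_indicator simp: emeasure_eq_measure)
  finally show ?thesis .
qed

text \<open>The recurrence for \<open>ln\<close> of the moment generating function at
  \<open>t = 0\<close>, with \<open>F i t\<close> the expectation of
  \<open>Z ^ i * exp (t * Z)\<close>; it links the analytic definition of \<open>cumulant\<close> to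
  moments.\<close>

lemma moment_cumulant:
  fixes Z :: "'a \<Rightarrow> real"
  assumes [measurable]: "Z \<in> borel_measurable M" and fin: "finite (Z ` space M)"
  shows "expectation (\<lambda>\<omega>. Z \<omega> ^ Suc s) =
    (\<Sum>i\<le>s. real (s choose i) * cumulant M (Suc i) Z * expectation (\<lambda>\<omega>. Z \<omega> ^ (s - i)))"
proof -
  define F where "F i t = expectation (\<lambda>\<omega>. Z \<omega> ^ i * exp (t * Z \<omega>))" for i t
  have F_eq: "F i t = (\<Sum>z\<in>Z ` space M. z ^ i * exp (t * z) * prob {\<omega> \<in> space M. Z \<omega> = z})" for i t
    unfolding F_def using fin by (intro expectation_finite_range) auto
  have "(F i has_real_derivative F (Suc i) t) (at t)" for i t
    unfolding F_eq[abs_def] by (auto intro!: derivative_eq_intros sum.cong simp: F_eq mult_ac)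
  moreover have "F 0 t > 0" for t
  proof -
    have "integrable M (\<lambda>\<omega>. exp (t * Z \<omega>))"
      using fin by (intro integrable_const_bound[where B="Max ((\<lambda>z. exp (t * z)) ` Z ` space M)"]) (auto intro!: AE_I2 Max_ge)
    then show ?thesis
      unfolding F_def using integral_less_AE_space[of "\<lambda>_. 0" "\<lambda>\<omega>. exp (t * Z \<omega>)"]
      by (auto simp: emeasure_space_1)
  qed
  ultimately have "F (Suc s) 0 = (\<Sum>i\<le>s. real (s choose i) * (deriv ^^ Suc i) (\<lambda>t. ln (F 0 t)) 0 * F (s - i) 0)"
    by (rule higher_deriv_ln_recurrence)
  then show ?thesis
    unfolding F_def cumulant_def by simp
qed

end

section \<open>Multilinear expansion of the cumulant of a sum\<close>

text \<open>A family on \<open>S\<close> is the same as a pair of families on \<open>T\<close> and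
  \<open>S - T\<close>; the witness glues such a pair together.\<close>

lemma sum_PiE_restrict:
  fixes f g :: "('i \<Rightarrow> 'b) \<Rightarrow> real"
  assumes "T \<subseteq> S"
  shows "(\<Sum>\<beta>\<in>PiE S (\<lambda>_. B). f (restrict \<beta> T) * g (restrict \<beta> (S - T))) =
    (\<Sum>\<beta>\<in>PiE T (\<lambda>_. B). f \<beta>) * (\<Sum>\<beta>\<in>PiE (S - T) (\<lambda>_. B). g \<beta>)"
proof -
  have "(\<Sum>\<beta>\<in>PiE S (\<lambda>_. B). f (restrict \<beta> T) * g (restrict \<beta> (S - T))) =
      (\<Sum>(\<alpha>, \<gamma>)\<in>PiE T (\<lambda>_. B) \<times> PiE (S - T) (\<lambda>_. B). f \<alpha> * g \<gamma>)"
    using assms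
    by (intro sum.reindex_bij_witness
        [where j = "\<lambda>\<beta>. (restrict \<beta> T, restrict \<beta> (S - T))"
          and i = "\<lambda>(\<alpha>, \<gamma>). \<lambda>x\<in>S. if x \<in> T then \<alpha> x else \<gamma> x"])
      (auto simp: fun_eq_iff PiE_iff extensional_def restrict_def subset_iff split: if_splits)
  then show ?thesis
    by (simp add: sum_product sum.cartesian_product)
qed

context prob_space
begin

lemma simple_function_prod_real:
  fixes f :: "'i \<Rightarrow> 'a \<Rightarrow> real"
  assumes "\<And>i. i \<in> T \<Longrightarrow> simple_function M (f i)"
  shows "simple_function M (\<lambda>\<omega>. \<Prod>i\<in>T. f i \<omega>)"
  using assms by (induction T rule: infinite_finite_induct) auto

lemma integrable_simple_function_real:
  fixes f :: "'a \<Rightarrow> real"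
  assumes "simple_function M f"
  shows "integrable M f"
  using assms by (rule integrable_simple_function) (simp add: emeasure_eq_measure)

text \<open>Both sides obey the same moment-cumulant recursion: summing over tuples turns moments of
  subfamilies into moments of the total, and splits each product over a block and its complement.
  General index sets \<open>S\<close> are needed because the induction passes to the blocks.\<close>

lemma cumulant_sum:
  fixes f :: "'b \<Rightarrow> 'a \<Rightarrow> real" and S :: "'i :: linorder set"
  assumes "finite B" and f: "\<And>b. b \<in> B \<Longrightarrow> simple_function M (f b)"
    and "finite S" "S \<noteq> {}"
  shows "cumulant M (card S) (\<lambda>\<omega>. \<Sum>b\<in>B. f b \<omega>) =
    (\<Sum>\<beta>\<in>PiE S (\<lambda>_. B). joint_cumulant (\<lambda>T. expectation (\<lambda>\<omega>. \<Prod>i\<in>T. f (\<beta> i) \<omega>)) S)"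
proof -
  define Z where "Z \<omega> = (\<Sum>b\<in>B. f b \<omega>)" for \<omega>
  define \<mu> where "\<mu> s = expectation (\<lambda>\<omega>. Z \<omega> ^ s)" for s
  define m where "m \<beta> T = expectation (\<lambda>\<omega>. \<Prod>i\<in>T. f (\<beta> i) \<omega>)" for \<beta> and T :: "'i set"
  define K where "K S = (\<Sum>\<beta>\<in>PiE S (\<lambda>_. B). joint_cumulant (m \<beta>) S)" for S
  have Z: "simple_function M Z"
    unfolding Z_def[abs_def] using f by (intro simple_function_sum)
  have m_sum: "(\<Sum>\<beta>\<in>PiE T (\<lambda>_. B). m \<beta> T) = \<mu> (card T)" if "finite T" for T
  proof -
    have "(\<Sum>\<beta>\<in>PiE T (\<lambda>_. B). m \<beta> T) = expectation (\<lambda>\<omega>. \<Sum>\<beta>\<in>PiE T (\<lambda>_. B). \<Prod>i\<in>T. f (\<beta> i) \<omega>)"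
      unfolding m_def
      by (intro Bochner_Integration.integral_sum[symmetric] integrable_simple_function_real
          simple_function_prod_real f) auto
    also have "\<dots> = \<mu> (card T)"
      using prod_sum_PiE[of T "\<lambda>_. B" "\<lambda>_ b. f b _"] that \<open>finite B\<close> by (simp add: \<mu>_def Z_def)
    finally show ?thesis .
  qed
  have m_restrict: "m (restrict \<beta> T) T = m \<beta> T" for \<beta> T
    by (simp add: m_def)
  have jc_restrict: "joint_cumulant (m (restrict \<beta> T)) T = joint_cumulant (m \<beta>) T" for \<beta> T
    unfolding m_def
    by (intro joint_cumulant_cong Bochner_Integration.integral_cong prod.cong refl) (auto simp: subset_iff)
  have "K S = cumulant M (card S) Z"
    using \<open>finite S\<close> \<open>S \<noteq> {}\<close>
  proof (induction S rule: finite_psubset_induct)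
    case (psubset S)
    define s where "s = Min S"
    define A where "A = S - {s}"
    define N where "N = card A"
    have s: "s \<in> S" using psubset.hyps psubset.prems s_def by simp
    have fA: "finite A" using psubset.hyps A_def by simp
    have cS: "card S = Suc N"
      using s psubset.hyps by (simp add: N_def A_def card_Suc_Diff1 del: card_Diff_insert)
    have card_diff: "card (S - insert s U) = N - card U" if "U \<subseteq> A" for U
    proof -
      have "S - insert s U = A - U" by (auto simp: A_def)
      then show ?thesis
        using card_Diff_subset[OF finite_subset[OF that fA] that] by (simp add: N_def)
    qed
    \<comment> \<open>\<open>F U\<close> and \<open>G U\<close> are the terms of the block
      \<open>insert s U\<close> in the two recursions, for \<open>Z\<close> itself and for the
      tuples; the complement of that block has \<open>N - card U\<close> elements.\<close>
    define F where "F U = cumulant M (Suc (card U)) Z * \<mu> (N - card U)" for U :: "'i set"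
    define G where "G U = K (insert s U) * \<mu> (N - card U)" for U
    have "\<mu> (Suc N) = (\<Sum>i\<le>N. real (N choose i) * (cumulant M (Suc i) Z * \<mu> (N - i)))"
      unfolding \<mu>_def
      using moment_cumulant[OF borel_measurable_simple_function[OF Z] simple_functionD(1)[OF Z], of N]
      by (simp add: mult.assoc)
    also have "\<dots> = (\<Sum>U\<in>Pow A. F U)"
      unfolding F_def N_def using fA by (rule sum_Pow_card[symmetric])
    finally have F: "\<mu> (Suc N) = (\<Sum>U\<in>Pow A. F U)" .
    have "\<mu> (Suc N) = (\<Sum>\<beta>\<in>PiE S (\<lambda>_. B). m \<beta> S)"
      using m_sum psubset.hyps cS by simp
    also have "\<dots> = (\<Sum>\<beta>\<in>PiE S (\<lambda>_. B). \<Sum>U\<in>Pow A.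
        joint_cumulant (m \<beta>) (insert s U) * m \<beta> (S - insert s U))"
      unfolding s_def A_def
      using psubset.hyps psubset.prems
      by (intro sum.cong moment_joint_cumulant) (auto simp: m_def prob_space)
    also have "\<dots> = (\<Sum>U\<in>Pow A. \<Sum>\<beta>\<in>PiE S (\<lambda>_. B).
        joint_cumulant (m (restrict \<beta> (insert s U))) (insert s U) *
        m (restrict \<beta> (S - insert s U)) (S - insert s U))"
      by (subst sum.swap) (simp add: m_restrict jc_restrict)
    also have "\<dots> = (\<Sum>U\<in>Pow A. G U)"
    proof (rule sum.cong)
      fix U assume "U \<in> Pow A"
      then have U: "insert s U \<subseteq> S" "U \<subseteq> A" using s by (auto simp: A_def)
      show "(\<Sum>\<beta>\<in>PiE S (\<lambda>_. B).
          joint_cumulant (m (restrict \<beta> (insert s U))) (insert s U) *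
          m (restrict \<beta> (S - insert s U)) (S - insert s U)) = G U"
        using psubset.hyps
        by (subst sum_PiE_restrict[OF U(1)]) (simp add: m_sum G_def K_def card_diff[OF U(2)])
    qed simp
    finally have "(\<Sum>U\<in>Pow A. F U) = (\<Sum>U\<in>Pow A. G U)"
      using F by simp
    moreover have "F U = G U" if "U \<in> Pow A - {A}" for U
    proof -
      have "insert s U \<subset> S" "s \<notin> U" "finite U"
        using that s fA by (auto simp: A_def intro: finite_subset)
      then show ?thesis
        using psubset.IH[of "insert s U"] by (simp add: F_def G_def)
    qed
    \<comment> \<open>The totals agree, and so do all terms but those of \<open>A\<close>; the
      moment factor of these last terms is \<open>\<mu> 0 = 1\<close>.\<close>
    ultimately have "F A = G A"
      using fA by (simp add: sum.remove[of "Pow A" A])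
    moreover have "insert s A = S"
      using s by (auto simp: A_def)
    ultimately show ?case
      by (simp add: F_def G_def cS N_def \<mu>_def prob_space)
  qed
  then show ?thesis
    by (simp add: K_def m_def[abs_def] Z_def[abs_def])
qed

end


section \<open>Edge probabilities\<close>

lemma prod_of_bool:
  fixes Q :: "'b \<Rightarrow> bool"
  assumes "finite P"
  shows "(\<Prod>e\<in>P. of_bool (Q e) :: real) = of_bool (\<forall>e\<in>P. Q e)"
  using assms by (induction P) auto

lemma doubleton_mem_rcm_edges:
  assumes "(a, b) \<in> index_pairs n"
  shows "{a, b} \<in> rcm_edges n H p X Y \<omega> \<longleftrightarrow> Y (a, b) \<omega> \<le> p * H (X a \<omega>) (X b \<omega>)"
proof
  assume "{a, b} \<in> rcm_edges n H p X Y \<omega>"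
  then obtain i j where ij: "{a, b} = {i, j}" "(i, j) \<in> index_pairs n"
      "Y (i, j) \<omega> \<le> p * H (X i \<omega>) (X j \<omega>)"
    unfolding rcm_edges_def by blast
  with assms have "a = i" "b = j"
    by (auto simp: index_pairs_def doubleton_eq_iff)
  with ij show "Y (a, b) \<omega> \<le> p * H (X a \<omega>) (X b \<omega>)" by simp
next
  assume "Y (a, b) \<omega> \<le> p * H (X a \<omega>) (X b \<omega>)"
  with assms show "{a, b} \<in> rcm_edges n H p X Y \<omega>"
    unfolding rcm_edges_def by blast
qed

text \<open>Translates the ordered pairs indexing \<open>Y\<close> into the two-element sets of
  \<open>rcm_edges\<close>. It is injective on \<open>index_pairs n\<close>, so edge counts are
  preserved.\<close>

definition pair_edge :: "nat \<times> nat \<Rightarrow> nat set" where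
  "pair_edge e = {fst e, snd e}"

lemma inj_on_pair_edge: "inj_on pair_edge (index_pairs n)"
  by (auto simp: inj_on_def pair_edge_def index_pairs_def doubleton_eq_iff)

lemma finite_index_pairs: "finite (index_pairs n)"
  by (rule finite_subset[of _ "{1..n} \<times> {1..n}"]) (auto simp: index_pairs_def)

lemma index_pairs_vertices:
  "e \<in> index_pairs n \<Longrightarrow> fst e \<in> {1..n} \<and> snd e \<in> {1..n}"
  by (auto simp: index_pairs_def)

lemma Union_pair_edge: "R \<subseteq> index_pairs n \<Longrightarrow> \<Union>(pair_edge ` R) \<subseteq> {1..n}"
  unfolding pair_edge_def using index_pairs_vertices by blast

section \<open>Probability that a prescribed set of edges is present\<close>

context binomial_rcm
begin

lemma X_measurable [measurable (raw)]: "i \<in> {1..n} \<Longrightarrow> X i \<in> borel_measurable M"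
  using X_indep by (simp add: indep_vars_def)

lemma Y_measurable [measurable (raw)]: "e \<in> index_pairs n \<Longrightarrow> Y e \<in> borel_measurable M"
  using Y_indep by (simp add: indep_vars_def)

lemma borel_measurable_H [measurable (raw)]:
  assumes "f \<in> borel_measurable N" "g \<in> borel_measurable N"
  shows "(\<lambda>x. H (f x) (g x)) \<in> borel_measurable N"
  using measurable_compose[OF measurable_Pair[OF assms] H_measurable] by simp

text \<open>Recasts \<open>XY_indep\<close> as a product form of the joint law, ready for Fubini.
  Checking rectangles suffices, since their preimages lie in the two independent
  sigma-algebras.\<close>

lemma joint_distr_X_Y:
  defines "S \<equiv> PiM {1..n} (\<lambda>_. borel :: (real ^ 'd) measure)"
    and "T \<equiv> PiM (index_pairs n) (\<lambda>_. borel :: real measure)"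
    and "U \<equiv> \<lambda>\<omega>. \<lambda>i\<in>{1..n}. X i \<omega>"
    and "V \<equiv> \<lambda>\<omega>. \<lambda>e\<in>index_pairs n. Y e \<omega>"
  shows "distr M S U \<Otimes>\<^sub>M distr M T V = distr M (S \<Otimes>\<^sub>M T) (\<lambda>\<omega>. (U \<omega>, V \<omega>))"
proof -
  \<comment> \<open>The coordinates are measurable for the sigma-algebra they generate, hence so is
    the whole vector. Proved once for both the points and the uniform variables.\<close>
  have sub: "sigma_sets (space M) {(\<lambda>\<omega>. \<lambda>i\<in>I. Z i \<omega>) -` A \<inter> space M | A. A \<in> sets (PiM I (\<lambda>_. borel))}
      \<subseteq> sigma_sets (space M) {Z i -` A \<inter> space M | i A. i \<in> I \<and> A \<in> sets borel}"
    for I :: "'i set" and Z :: "'i \<Rightarrow> 'w \<Rightarrow> 'z :: topological_space"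
  proof (rule sigma_sets_mono)
    let ?G = "{Z i -` A \<inter> space M | i A. i \<in> I \<and> A \<in> sets borel}"
    have G: "?G \<subseteq> Pow (space M)" by auto
    have "Z i \<in> sigma (space M) ?G \<rightarrow>\<^sub>M borel" if "i \<in> I" for i
      using that G by (intro measurableI) (auto simp: sets_measure_of space_measure_of_conv intro!: sigma_sets.Basic)
    then have "(\<lambda>\<omega>. \<lambda>i\<in>I. Z i \<omega>) \<in> sigma (space M) ?G \<rightarrow>\<^sub>M PiM I (\<lambda>_. borel)"
      by (intro measurable_restrict)
    then show "{(\<lambda>\<omega>. \<lambda>i\<in>I. Z i \<omega>) -` A \<inter> space M | A. A \<in> sets (PiM I (\<lambda>_. borel))}
        \<subseteq> sigma_sets (space M) ?G"
      using G by (auto simp: measurable_def sets_measure_of space_measure_of_conv)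
  qed
  have [measurable]: "U \<in> M \<rightarrow>\<^sub>M S" "V \<in> M \<rightarrow>\<^sub>M T"
    unfolding U_def V_def S_def T_def by measurable
  interpret DS: prob_space "distr M S U" by (rule prob_space_distr) measurable
  interpret DT: prob_space "distr M T V" by (rule prob_space_distr) measurable
  show ?thesis
  proof (rule pair_measure_eqI)
    fix A B assume "A \<in> sets (distr M S U)" "B \<in> sets (distr M T V)"
    then have A [measurable]: "A \<in> sets S" and B [measurable]: "B \<in> sets T" by simp_all
    have "prob ((U -` A \<inter> space M) \<inter> (V -` B \<inter> space M)) = prob (U -` A \<inter> space M) * prob (V -` B \<inter> space M)"
    proof (rule indep_setD[OF XY_indep])
      show "U -` A \<inter> space M \<in> sigma_sets (space M) {X i -` A \<inter> space M | i A. i \<in> {1..n} \<and> A \<in> sets borel}"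
        using sub[of X "{1..n}"] A unfolding U_def S_def by blast
      show "V -` B \<inter> space M \<in> sigma_sets (space M) {Y e -` B \<inter> space M | e B. e \<in> index_pairs n \<and> B \<in> sets borel}"
        using sub[of Y "index_pairs n"] B unfolding V_def T_def by blast
    qed
    moreover have "(\<lambda>\<omega>. (U \<omega>, V \<omega>)) -` (A \<times> B) \<inter> space M = (U -` A \<inter> space M) \<inter> (V -` B \<inter> space M)"
      by auto
    ultimately show "emeasure (distr M S U) A * emeasure (distr M T V) B =
        emeasure (distr M (S \<Otimes>\<^sub>M T) (\<lambda>\<omega>. (U \<omega>, V \<omega>))) (A \<times> B)"
      by (simp add: emeasure_distr emeasure_eq_measure flip: ennreal_mult)
  qed (simp_all add: DS.sigma_finite_measure_axioms DT.sigma_finite_measure_axioms)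
qed

lemma prob_Y_le:
  assumes "e \<in> index_pairs n" "0 \<le> c" "c \<le> 1"
  shows "expectation (\<lambda>\<omega>. of_bool (Y e \<omega> \<le> c)) = c"
proof -
  have "expectation (\<lambda>\<omega>. of_bool (Y e \<omega> \<le> c) :: real) = (LINT y|distr M borel (Y e). of_bool (y \<le> c))"
    by (rule integral_distr[where f="\<lambda>y. of_bool (y \<le> c)", symmetric]) (use assms(1) in measurable)
  also have "\<dots> = (LINT y|distr M borel (Y e). indicator {..c} y)"
    by (intro Bochner_Integration.integral_cong) (auto simp: indicator_def)
  also have "\<dots> = measure lborel ({0..1} \<inter> {..c})"
    using assms by (simp add: Y_distr)
  also have "{0..1} \<inter> {..c} = {0..c}"
    using assms by auto
  finally show ?thesis using assms by simp
qed

text \<open>Conditioning on the points, carried out by Fubini: once the points are fixed, the edges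
  are independent and have probabilities \<open>p * H\<close>.\<close>

lemma expectation_edges:
  assumes P: "P \<subseteq> index_pairs n"
  shows "expectation (\<lambda>\<omega>. of_bool (pair_edge ` P \<subseteq> rcm_edges n H p X Y \<omega>)) =
    expectation (\<lambda>\<omega>. \<Prod>e\<in>P. p * H (X (fst e) \<omega>) (X (snd e) \<omega>))"
proof -
  define g :: "(nat \<Rightarrow> real ^ 'd) \<times> (nat \<times> nat \<Rightarrow> real) \<Rightarrow> real" where
    "g = (\<lambda>(x, y). \<Prod>e\<in>P. of_bool (y e \<le> p * H (x (fst e)) (x (snd e))))"
  define S :: "(nat \<Rightarrow> real ^ 'd) measure" where "S = PiM {1..n} (\<lambda>_. borel)"
  define T :: "(nat \<times> nat \<Rightarrow> real) measure" where "T = PiM (index_pairs n) (\<lambda>_. borel)"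
  define U where "U = (\<lambda>\<omega>. \<lambda>i\<in>{1..n}. X i \<omega>)"
  define V where "V = (\<lambda>\<omega>. \<lambda>e\<in>index_pairs n. Y e \<omega>)"
  have fP: "finite P"
    using P finite_index_pairs finite_subset by blast
  have U [measurable]: "U \<in> M \<rightarrow>\<^sub>M S" and V [measurable]: "V \<in> M \<rightarrow>\<^sub>M T"
    unfolding U_def V_def S_def T_def by measurable
  have vs: "fst e \<in> {1..n}" "snd e \<in> {1..n}" "e \<in> index_pairs n" if "e \<in> P" for e
    using P index_pairs_vertices that by blast+
  have g [measurable]: "g \<in> borel_measurable (S \<Otimes>\<^sub>M T)"
  proof -
    have [measurable]: "(\<lambda>z. fst z i) \<in> borel_measurable (S \<Otimes>\<^sub>M T)" if "i \<in> {1..n}" for i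
      using that unfolding S_def by measurable
    have [measurable]: "(\<lambda>z. snd z e) \<in> borel_measurable (S \<Otimes>\<^sub>M T)" if "e \<in> index_pairs n" for e
      using that unfolding T_def by measurable
    show ?thesis
      unfolding g_def case_prod_beta using vs by measurable
  qed
  interpret DS: prob_space "distr M S U" by (rule prob_space_distr) (rule U)
  interpret DT: prob_space "distr M T V" by (rule prob_space_distr) (rule V)
  interpret DST: pair_prob_space "distr M S U" "distr M T V" ..
  have g01: "0 \<le> g z" "g z \<le> 1" for z
    by (auto simp: g_def case_prod_beta intro!: prod_nonneg prod_le_1)
  have joint: "distr M S U \<Otimes>\<^sub>M distr M T V = distr M (S \<Otimes>\<^sub>M T) (\<lambda>\<omega>. (U \<omega>, V \<omega>))"
    using joint_distr_X_Y unfolding S_def T_def U_def V_def .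
  have "expectation (\<lambda>\<omega>. of_bool (pair_edge ` P \<subseteq> rcm_edges n H p X Y \<omega>)) = expectation (\<lambda>\<omega>. g (U \<omega>, V \<omega>))"
  proof (rule Bochner_Integration.integral_cong)
    fix \<omega>
    have "pair_edge e \<in> rcm_edges n H p X Y \<omega> \<longleftrightarrow> V \<omega> e \<le> p * H (U \<omega> (fst e)) (U \<omega> (snd e))"
      if "e \<in> P" for e
      using doubleton_mem_rcm_edges[of "fst e" "snd e" n H p X Y \<omega>] vs[OF that]
      by (simp add: pair_edge_def U_def V_def)
    then show "of_bool (pair_edge ` P \<subseteq> rcm_edges n H p X Y \<omega>) = g (U \<omega>, V \<omega>)"
      using fP by (auto simp: g_def prod_of_bool image_subset_iff)
  qed simp
  also have "\<dots> = (LINT z|(distr M S U \<Otimes>\<^sub>M distr M T V). g z)"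
    unfolding joint by (subst integral_distr) auto
  also have "\<dots> = (LINT x|distr M S U. LINT y|distr M T V. g (x, y))"
    using g01 by (intro DST.integral_fst'[symmetric] DST.P.integrable_const_bound[where B=1]) auto
  also have "\<dots> = (LINT x|distr M S U. (\<Prod>e\<in>P. p * H (x (fst e)) (x (snd e))))"
  proof (rule Bochner_Integration.integral_cong)
    fix x :: "nat \<Rightarrow> real ^ 'd"
    \<comment> \<open>For fixed \<open>x\<close> the thresholds are constants in
      \<open>[0, 1]\<close>, so independence of the \<open>Y e\<close> factorises the inner
      integral.\<close>
    define c where "c e = p * H (x (fst e)) (x (snd e))" for e
    have c: "0 \<le> c e" "c e \<le> 1" for e
      using H_range[of "x (fst e)" "x (snd e)"] p_range by (auto simp: c_def intro!: mult_le_one)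
    have "(LINT y|distr M T V. g (x, y)) = (LINT y|distr M T V. (\<Prod>e\<in>P. of_bool (y e \<le> c e)))"
      by (simp add: g_def c_def)
    also have "\<dots> = expectation (\<lambda>\<omega>. \<Prod>e\<in>P. of_bool (V \<omega> e \<le> c e))"
    proof (rule integral_distr)
      show "(\<lambda>y. \<Prod>e\<in>P. of_bool (y e \<le> c e) :: real) \<in> borel_measurable T"
        unfolding T_def using vs by measurable
    qed (rule V)
    also have "\<dots> = expectation (\<lambda>\<omega>. \<Prod>e\<in>P. of_bool (Y e \<omega> \<le> c e))"
      using vs by (auto simp: V_def intro!: Bochner_Integration.integral_cong prod.cong)
    also have "\<dots> = (\<Prod>e\<in>P. expectation (\<lambda>\<omega>. of_bool (Y e \<omega> \<le> c e)))"
    proof (rule indep_vars_lebesgue_integral[OF fP])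
      show "indep_vars (\<lambda>_. borel) (\<lambda>e \<omega>. of_bool (Y e \<omega> \<le> c e) :: real) P"
        by (rule indep_vars_compose2[OF indep_vars_subset[OF Y_indep P]]) measurable
      show "integrable M (\<lambda>\<omega>. of_bool (Y e \<omega> \<le> c e) :: real)" if "e \<in> P" for e
        using vs[OF that] by (intro integrable_const_bound[where B=1]) auto
    qed
    also have "\<dots> = (\<Prod>e\<in>P. c e)"
      using vs c by (intro prod.cong prob_Y_le) auto
    finally show "(LINT y|distr M T V. g (x, y)) = (\<Prod>e\<in>P. p * H (x (fst e)) (x (snd e)))"
      by (simp add: c_def)
  qed simp
  also have "\<dots> = expectation (\<lambda>\<omega>. \<Prod>e\<in>P. p * H (U \<omega> (fst e)) (U \<omega> (snd e)))"
  proof (rule integral_distr)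
    show "(\<lambda>x. \<Prod>e\<in>P. p * H (x (fst e)) (x (snd e))) \<in> borel_measurable S"
      unfolding S_def using vs by measurable
  qed (rule U)
  also have "\<dots> = expectation (\<lambda>\<omega>. \<Prod>e\<in>P. p * H (X (fst e) \<omega>) (X (snd e) \<omega>))"
    using vs by (auto simp: U_def intro!: Bochner_Integration.integral_cong prod.cong)
  finally show ?thesis .
qed

lemma edge_factor_bounds: "0 \<le> p * H x y" "p * H x y \<le> p" "p * H x y \<le> 1"
  using H_range[of x y] p_range by (auto intro!: mult_le_one mult_left_le)

lemma edge_product_bounds:
  "0 \<le> (\<Prod>e\<in>P. p * H (f e) (g e))" "(\<Prod>e\<in>P. p * H (f e) (g e)) \<le> 1"
  "(\<Prod>e\<in>P. p * H (f e) (g e)) \<le> p ^ card P"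
  using prod_mono[of P "\<lambda>e. p * H (f e) (g e)" "\<lambda>_. p"]
  by (auto intro!: prod_nonneg prod_le_1 edge_factor_bounds)

lemma integrable_edge_product:
  assumes P: "P \<subseteq> index_pairs n"
  shows "integrable M (\<lambda>\<omega>. \<Prod>e\<in>P. p * H (X (fst e) \<omega>) (X (snd e) \<omega>))"
proof (rule integrable_const_bound[where B=1])
  have vs: "fst e \<in> {1..n}" "snd e \<in> {1..n}" if "e \<in> P" for e
    using P index_pairs_vertices that by blast+
  show "(\<lambda>\<omega>. \<Prod>e\<in>P. p * H (X (fst e) \<omega>) (X (snd e) \<omega>)) \<in> borel_measurable M"
    using vs by measurable
qed (simp add: edge_product_bounds)

lemma pair_edge_surj:
  assumes "D \<subseteq> pair_edge ` index_pairs n"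
  obtains P where "P \<subseteq> index_pairs n" "D = pair_edge ` P" "card P = card D"
  using assms subset_imageE card_image inj_on_subset[OF inj_on_pair_edge] by metis

text \<open>Each conditional edge probability is at most \<open>p\<close> because \<open>H\<close>
  is at most 1.\<close>

lemma prob_edges_le:
  assumes "D \<subseteq> pair_edge ` index_pairs n"
  shows "expectation (\<lambda>\<omega>. of_bool (D \<subseteq> rcm_edges n H p X Y \<omega>)) \<le> p ^ card D"
proof -
  obtain P where P: "P \<subseteq> index_pairs n" "D = pair_edge ` P" "card P = card D"
    using pair_edge_surj[OF assms] .
  have "expectation (\<lambda>\<omega>. \<Prod>e\<in>P. p * H (X (fst e) \<omega>) (X (snd e) \<omega>)) \<le> expectation (\<lambda>_. p ^ card P)"
    using P by (intro integral_mono integrable_edge_product edge_product_bounds) auto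
  then show ?thesis
    using P by (simp add: expectation_edges prob_space)
qed

text \<open>The two products of conditional probabilities involve disjoint groups of points, hence
  are independent. Sharing no edge would not be enough: a common vertex can correlate them through
  its position.\<close>

lemma prob_edges_Un:
  assumes "D \<subseteq> pair_edge ` index_pairs n" "D' \<subseteq> pair_edge ` index_pairs n" "\<Union>D \<inter> \<Union>D' = {}"
  shows "expectation (\<lambda>\<omega>. of_bool (D \<union> D' \<subseteq> rcm_edges n H p X Y \<omega>)) =
    (expectation (\<lambda>\<omega>. of_bool (D \<subseteq> rcm_edges n H p X Y \<omega>)) :: real) *
    expectation (\<lambda>\<omega>. of_bool (D' \<subseteq> rcm_edges n H p X Y \<omega>))"
proof -
  obtain P where P: "P \<subseteq> index_pairs n" "D = pair_edge ` P"
    using pair_edge_surj[OF assms(1)] .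
  obtain Q where Q: "Q \<subseteq> index_pairs n" "D' = pair_edge ` Q"
    using pair_edge_surj[OF assms(2)] .
  have fin: "finite P" "finite Q"
    using P Q finite_index_pairs finite_subset by blast+
  have disj: "P \<inter> Q = {}"
    using assms(3) unfolding P Q by (auto simp: pair_edge_def)
  define h where "h R x = (\<Prod>e\<in>R. p * H (x (fst e)) (x (snd e)))"
    for R :: "(nat \<times> nat) set" and x :: "nat \<Rightarrow> real ^ 'd"
  have vD: "fst e \<in> \<Union>D" "snd e \<in> \<Union>D" if "e \<in> P" for e
    using that P by (auto simp: pair_edge_def)
  have vD': "fst e \<in> \<Union>D'" "snd e \<in> \<Union>D'" if "e \<in> Q" for e
    using that Q by (auto simp: pair_edge_def)
  have sub: "\<Union>D \<subseteq> {1..n}" "\<Union>D' \<subseteq> {1..n}"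
    unfolding P(2) Q(2) by (intro Union_pair_edge P(1) Q(1))+
  have [measurable]: "h P \<in> borel_measurable (PiM (\<Union>D) (\<lambda>_. borel))"
    unfolding h_def using vD by measurable
  have [measurable]: "h Q \<in> borel_measurable (PiM (\<Union>D') (\<lambda>_. borel))"
    unfolding h_def using vD' by measurable
  have hP: "h P (\<lambda>i\<in>\<Union>D. X i \<omega>) = h P (\<lambda>i. X i \<omega>)" for \<omega>
    unfolding h_def using vD by (auto intro!: prod.cong)
  have hQ: "h Q (\<lambda>i\<in>\<Union>D'. X i \<omega>) = h Q (\<lambda>i. X i \<omega>)" for \<omega>
    unfolding h_def using vD' by (auto intro!: prod.cong)
  have "indep_var borel (h P \<circ> (\<lambda>\<omega>. \<lambda>i\<in>\<Union>D. X i \<omega>)) borel (h Q \<circ> (\<lambda>\<omega>. \<lambda>i\<in>\<Union>D'. X i \<omega>))"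
    by (rule indep_var_compose[OF indep_var_restrict[OF X_indep assms(3) sub]]) measurable
  then have ind: "indep_var borel (\<lambda>\<omega>. h P (\<lambda>i. X i \<omega>)) borel (\<lambda>\<omega>. h Q (\<lambda>i. X i \<omega>))"
    by (simp add: comp_def hP hQ)
  have "expectation (\<lambda>\<omega>. of_bool (D \<union> D' \<subseteq> rcm_edges n H p X Y \<omega>))
      = expectation (\<lambda>\<omega>. h (P \<union> Q) (\<lambda>i. X i \<omega>))"
    using expectation_edges[of "P \<union> Q"] P Q by (simp add: h_def image_Un)
  also have "\<dots> = expectation (\<lambda>\<omega>. h P (\<lambda>i. X i \<omega>) * h Q (\<lambda>i. X i \<omega>))"
    using fin disj by (simp add: h_def prod.union_disjoint)
  also have "\<dots> = expectation (\<lambda>\<omega>. h P (\<lambda>i. X i \<omega>)) * expectation (\<lambda>\<omega>. h Q (\<lambda>i. X i \<omega>))"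
    using integrable_edge_product[OF P(1)] integrable_edge_product[OF Q(1)]
    by (intro indep_var_lebesgue_integral[OF ind]) (simp_all add: h_def)
  finally show ?thesis
    using P Q by (simp add: h_def expectation_edges)
qed

lemma measurable_edges:
  assumes "D \<subseteq> pair_edge ` index_pairs n"
  shows "Measurable.pred M (\<lambda>\<omega>. D \<subseteq> rcm_edges n H p X Y \<omega>)"
proof -
  obtain P where P: "P \<subseteq> index_pairs n" "D = pair_edge ` P"
    using pair_edge_surj[OF assms] .
  have vs: "fst e \<in> {1..n}" "snd e \<in> {1..n}" "e \<in> index_pairs n" if "e \<in> P" for e
    using P index_pairs_vertices that by blast+
  have fP: "finite P"
    using P finite_index_pairs finite_subset by blast
  have mem: "pair_edge e \<in> rcm_edges n H p X Y \<omega> \<longleftrightarrow> Y e \<omega> \<le> p * H (X (fst e) \<omega>) (X (snd e) \<omega>)"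
    if "e \<in> P" for e \<omega>
    using doubleton_mem_rcm_edges[of "fst e" "snd e" n H p X Y \<omega>] vs(3)[OF that]
    by (simp add: pair_edge_def)
  have "D \<subseteq> rcm_edges n H p X Y \<omega> \<longleftrightarrow> (\<forall>e\<in>P. Y e \<omega> \<le> p * H (X (fst e) \<omega>) (X (snd e) \<omega>))" for \<omega>
    unfolding P(2) image_subset_iff by (intro ball_cong mem refl)
  moreover have "Measurable.pred M (\<lambda>\<omega>. \<forall>e\<in>P. Y e \<omega> \<le> p * H (X (fst e) \<omega>) (X (snd e) \<omega>))"
    using vs fP by (intro pred_intros_finite) measurable
  ultimately show ?thesis by simp
qed

end


section \<open>Kernel partitions\<close>

text \<open>The fibres of \<open>f\<close> on \<open>A\<close>. For a tuple \<open>b\<close> of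
  embeddings and \<open>f = case_prod b\<close> on the grid, they record which vertices of the
  copies coincide.\<close>

definition kernel_partition :: "'a set \<Rightarrow> ('a \<Rightarrow> 'b) \<Rightarrow> 'a set set" where
  "kernel_partition A f = (\<lambda>v. {x \<in> A. f x = v}) ` f ` A"

text \<open>On a block of the kernel partition the choice is immaterial, as \<open>f\<close> is
  constant there.\<close>

definition block_value :: "('a \<Rightarrow> 'b) \<Rightarrow> 'a set \<Rightarrow> 'b" where
  "block_value f P = f (SOME x. x \<in> P)"

text \<open>Connectedness of the intersection graph, expressed by cuts; a failing cut is exactly the
  splitting that \<open>joint_cumulant_eq_0\<close> asks for.\<close>

definition linked_family :: "'i set \<Rightarrow> ('i \<Rightarrow> 'b set) \<Rightarrow> bool" where
  "linked_family I V \<longleftrightarrow>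
     (\<forall>A\<subseteq>I. A \<noteq> {} \<longrightarrow> A \<noteq> I \<longrightarrow> (\<Union>i\<in>A. V i) \<inter> (\<Union>i\<in>I - A. V i) \<noteq> {})"

lemma partition_on_kernel_partition: "partition_on A (kernel_partition A f)"
  by (rule partition_onI) (auto simp: kernel_partition_def disjnt_iff)

lemma card_kernel_partition: "card (kernel_partition A f) = card (f ` A)"
  unfolding kernel_partition_def by (rule card_image) (auto simp: inj_on_def)

lemma kernel_partition_block:
  assumes "x \<in> A"
  shows "{y \<in> A. f y = f x} \<in> kernel_partition A f"
  using assms by (auto simp: kernel_partition_def)

lemma kernel_partition_same:
  assumes "P \<in> kernel_partition A f" "x \<in> P" "y \<in> P"
  shows "f x = f y"
  using assms by (auto simp: kernel_partition_def)

lemma block_value_eq: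
  assumes "P \<in> kernel_partition A f" "x \<in> P"
  shows "block_value f P = f x"
  unfolding block_value_def
  by (rule kernel_partition_same[OF assms(1) someI assms(2)]) (rule assms(2))

lemma inj_on_block_value: "inj_on (block_value f) (kernel_partition A f)"
proof (rule inj_onI)
  fix P Q assume PQ: "P \<in> kernel_partition A f" "Q \<in> kernel_partition A f"
    and eq: "block_value f P = block_value f Q"
  obtain x where x: "x \<in> A" "P = {y \<in> A. f y = f x}"
    using PQ(1) by (auto simp: kernel_partition_def)
  obtain x' where x': "x' \<in> A" "Q = {y \<in> A. f y = f x'}"
    using PQ(2) by (auto simp: kernel_partition_def)
  have "f x = f x'"
    using block_value_eq[OF PQ(1), of x] block_value_eq[OF PQ(2), of x'] eq x x' by simp
  with x x' show "P = Q" by simp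
qed

text \<open>The sets are added one at a time, each meeting the union so far, so each after the first
  brings at most \<open>k - 1\<close> new elements. This yields the upper limit of the sum over
  \<open>r\<close>.\<close>

lemma card_Union_linked_family_le:
  assumes "finite I" "I \<noteq> {}" and V: "\<And>i. i \<in> I \<Longrightarrow> finite (V i) \<and> card (V i) = k"
    and linked: "linked_family I V"
  shows "card (\<Union>i\<in>I. V i) \<le> 1 + (k - 1) * card I"
proof -
  have "\<exists>A\<subseteq>I. card A = Suc m \<and> card (\<Union>i\<in>A. V i) \<le> 1 + (k - 1) * Suc m" if "Suc m \<le> card I" for m
    using that
  proof (induction m)
    case 0
    obtain i where "i \<in> I" using assms by auto
    then show ?case
      using V[of i] by (intro exI[of _ "{i}"]) auto
  next
    case (Suc m)
    then obtain A where A: "A \<subseteq> I" "card A = Suc m" "card (\<Union>i\<in>A. V i) \<le> 1 + (k - 1) * Suc m"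
      by auto
    have fA: "finite A" using A assms(1) finite_subset by blast
    have "A \<noteq> {}" "A \<noteq> I"
      using A Suc.prems by auto
    then have "(\<Union>i\<in>A. V i) \<inter> (\<Union>i\<in>I - A. V i) \<noteq> {}"
      using linked A unfolding linked_family_def by blast
    then obtain i v where i: "i \<in> I" "i \<notin> A" and v: "v \<in> V i" "v \<in> (\<Union>i\<in>A. V i)"
      by blast
    \<comment> \<open>The element \<open>v\<close> supplied by the cut at \<open>A\<close> is
      already counted.\<close>
    have "(\<Union>i\<in>insert i A. V i) = (\<Union>i\<in>A. V i) \<union> (V i - {v})"
      using v by auto
    then have "card (\<Union>i\<in>insert i A. V i) \<le> card (\<Union>i\<in>A. V i) + card (V i - {v})"
      by (simp add: card_Un_le)
    also have "card (V i - {v}) = k - 1"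
      using V[OF i(1)] v by simp
    finally have "card (\<Union>i\<in>insert i A. V i) \<le> 1 + (k - 1) * Suc (Suc m)"
      using A by simp
    then show ?case
      using i A fA by (intro exI[of _ "insert i A"]) auto
  qed
  from this[of "card I - 1"] obtain A where A: "A \<subseteq> I" "card A = card I"
      "card (\<Union>i\<in>A. V i) \<le> 1 + (k - 1) * card I"
    using assms(1,2) by (auto simp: card_gt_0_iff)
  then have "A = I"
    using assms(1) card_subset_eq by blast
  with A show ?thesis by simp
qed

section \<open>Partitions of the grid induced by tuples of maps\<close>

lemma finite_grid: "finite (grid j k)"
  by (simp add: grid_def)

lemma partition_on_rows: "1 \<le> k \<Longrightarrow> partition_on (grid j k) (rows j k)"
  by (rule partition_onI) (fastforce simp: rows_def grid_def disjnt_iff)+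

lemma finite_conn_nonflat: "finite (conn_nonflat j k r)"
  by (rule finite_subset[of _ "Pow (Pow (grid j k))"])
    (auto simp: conn_nonflat_def partition_on_def finite_grid)

text \<open>Within a row the values are distinct, so a fibre meets each row in at most one cell.
  Equality with the singleton partition follows from refinement in both directions.\<close>

lemma non_flat_kernel_partition:
  assumes "1 \<le> k" and inj: "\<And>i. i \<in> {1..j} \<Longrightarrow> inj_on (b i) {1..k}"
  shows "non_flat j k (kernel_partition (grid j k) (case_prod b))"
proof -
  let ?\<rho> = "kernel_partition (grid j k) (case_prod b)"
  let ?R = "common_refinement {?\<rho>, rows j k}"
  let ?S = "(\<lambda>x. {x}) ` grid j k"
  have part: "partition_on (grid j k) Q" if "Q \<in> {?\<rho>, rows j k}" for Q
    using that partition_on_kernel_partition partition_on_rows[OF assms(1)] by auto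
  have R: "partition_on (grid j k) ?R"
    by (rule partition_on_common_refinement[OF part]) auto
  have S: "partition_on (grid j k) ?S"
    by (rule partition_onI) (auto simp: disjnt_iff)
  have "\<exists>Y\<in>?S. P \<subseteq> Y" if P: "P \<in> ?R" for P
  proof -
    obtain B where B: "B \<in> ?\<rho>" "P \<subseteq> B"
      using common_refinement_exists[OF P, of ?\<rho>] by auto
    obtain i where i: "i \<in> {1..j}" "P \<subseteq> {i} \<times> {1..k}"
      using common_refinement_exists[OF P, of "rows j k"] by (auto simp: rows_def)
    have "P \<noteq> {}" "P \<subseteq> grid j k"
      using P partition_onD1[OF R] partition_onD3[OF R] by blast+
    then obtain x where x: "x \<in> P" "x \<in> grid j k"
      by blast
    have "y = x" if y: "y \<in> P" for y
    proof -
      obtain l m where lm: "x = (i, l)" "y = (i, m)" "l \<in> {1..k}" "m \<in> {1..k}"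
        using subsetD[OF i(2) x(1)] subsetD[OF i(2) y] by auto
      have "case_prod b y = case_prod b x"
        by (rule kernel_partition_same[OF B(1)]) (use B y x in auto)
      then have "b i m = b i l"
        by (simp add: lm)
      then have "m = l"
        using inj_onD[OF inj[OF i(1)]] lm(3,4) by blast
      then show ?thesis
        by (simp add: lm)
    qed
    then have "P \<subseteq> {x}" by blast
    then show ?thesis using x(2) by blast
  qed
  moreover have "\<exists>Y\<in>?R. P \<subseteq> Y" if "P \<in> ?S" for P
  proof -
    obtain x where x: "P = {x}" "x \<in> \<Union>?R"
      using \<open>P \<in> ?S\<close> partition_onD1[OF R] by auto
    then show ?thesis by blast
  qed
  ultimately show ?thesis
    unfolding non_flat_def using R S by (intro refines_asym[of "grid j k"]) (simp_all add: refines_def)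
qed

text \<open>A block of the join is a union of full rows. If it were not the whole grid, its rows
  would form a cut; the vertex shared across that cut ties a further row to the same block.\<close>

lemma connected_kernel_partition:
  assumes jk: "1 \<le> j" "1 \<le> k" and linked: "linked_family {1..j} (\<lambda>i. b i ` {1..k})"
  shows "connected_partition j k (kernel_partition (grid j k) (case_prod b))"
proof (rule ccontr)
  let ?\<rho> = "kernel_partition (grid j k) (case_prod b)"
  define R where "R = partition_join (grid j k) ?\<rho> (rows j k)"
  assume "\<not> connected_partition j k ?\<rho>"
  then have ne: "R \<noteq> {grid j k}"
    by (simp add: connected_partition_def R_def)
  have "is_partition_join (grid j k) ?\<rho> (rows j k) R"
    unfolding R_def
    by (intro is_partition_join_partition_join partition_on_kernel_partition partition_on_rows jk)
  then have ref: "refines (grid j k) ?\<rho> R" "refines (grid j k) (rows j k) R"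
    by (auto simp: is_partition_join_def)
  then have R: "\<Union>R = grid j k" "\<And>P Q. P \<in> R \<Longrightarrow> Q \<in> R \<Longrightarrow> P \<inter> Q \<noteq> {} \<Longrightarrow> P = Q" "{} \<notin> R"
  proof -
    have "partition_on (grid j k) R" using ref by (simp add: refines_def)
    then have "\<Union>R = grid j k" "disjoint R" "{} \<notin> R" by (simp_all add: partition_on_def)
    then show "\<Union>R = grid j k" "\<And>P Q. P \<in> R \<Longrightarrow> Q \<in> R \<Longrightarrow> P \<inter> Q \<noteq> {} \<Longrightarrow> P = Q" "{} \<notin> R"
      by (blast dest: disjointD)+
  qed
  have "grid j k \<noteq> {}" using jk by (auto simp: grid_def)
  then have "R \<noteq> {}" using R(1) by auto
  then obtain U where U: "U \<in> R" "U \<noteq> grid j k"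
    using ne by blast
  have row: "{i} \<times> {1..k} \<subseteq> U" if "i \<in> {1..j}" "(i, l) \<in> U" "l \<in> {1..k}" for i l
  proof -
    have "{i} \<times> {1..k} \<in> rows j k"
      using that by (auto simp: rows_def)
    then obtain W where W: "W \<in> R" "{i} \<times> {1..k} \<subseteq> W"
      using ref(2) unfolding refines_def by blast
    then show ?thesis
      using R(2)[of W U] U that by blast
  qed
  define A where "A = {i \<in> {1..j}. {i} \<times> {1..k} \<subseteq> U}"
  have "U \<subseteq> grid j k" "U \<noteq> {}" using U R by auto
  then obtain i l where "(i, l) \<in> U" "i \<in> {1..j}" "l \<in> {1..k}"
    by (fastforce simp: grid_def)
  then have "i \<in> A"
    using row by (simp add: A_def)
  then have "A \<noteq> {}" by blast
  moreover have "A \<noteq> {1..j}"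
  proof
    assume "A = {1..j}"
    then have "grid j k \<subseteq> U" by (auto simp: A_def grid_def)
    with \<open>U \<subseteq> grid j k\<close> U show False by auto
  qed
  moreover have "A \<subseteq> {1..j}" by (auto simp: A_def)
  ultimately have "(\<Union>i\<in>A. b i ` {1..k}) \<inter> (\<Union>i\<in>{1..j} - A. b i ` {1..k}) \<noteq> {}"
    using linked unfolding linked_family_def by blast
  then obtain i i' l l' where i: "i \<in> A" "i' \<in> {1..j}" "i' \<notin> A"
    and l: "l \<in> {1..k}" "l' \<in> {1..k}" and eq: "b i l = b i' l'"
    by blast
  have mem: "(i, l) \<in> grid j k" "(i', l') \<in> grid j k"
    using i l by (auto simp: A_def grid_def)
  \<comment> \<open>The fibre of the shared vertex contains \<open>(i, l)\<close> and
    \<open>(i', l')\<close> and sits inside one block of the join, which must be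
    \<open>U\<close>.\<close>
  obtain W where W: "W \<in> R" "{y \<in> grid j k. case_prod b y = case_prod b (i, l)} \<subseteq> W"
    using ref(1) kernel_partition_block[OF mem(1), of "case_prod b"] unfolding refines_def by blast
  have "(i, l) \<in> W" "(i', l') \<in> W"
    using W(2) mem eq by auto
  moreover have "(i, l) \<in> U"
    using i(1) l(1) unfolding A_def by blast
  ultimately have "(i', l') \<in> U"
    using R(2)[OF W(1) U(1)] by blast
  then have "i' \<in> A"
    using row[OF i(2) _ l(2)] i(2) by (simp add: A_def)
  with i show False by simp
qed

text \<open>Replacing each block by its common value embeds the edges of the block graph into the
  union of the image edges, since distinct blocks have distinct values.\<close>

lemma card_quotient_edges_le:
  assumes E: "\<And>e. e \<in> E \<Longrightarrow> e \<subseteq> {1..k}"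
  shows "card (quotient_edges j E (kernel_partition (grid j k) (case_prod b)))
    \<le> card (\<Union>i\<in>{1..j}. (`) (b i) ` E)"
proof -
  let ?\<rho> = "kernel_partition (grid j k) (case_prod b)"
  let ?w = "block_value (case_prod b)"
  have "E \<subseteq> Pow {1..k}" using E by auto
  then have "finite E" by (rule finite_subset) simp
  have "quotient_edges j E ?\<rho> \<subseteq> Pow ?\<rho>"
    by (auto simp: quotient_edges_def)
  then have "inj_on ((`) ?w) (quotient_edges j E ?\<rho>)"
    by (rule inj_on_subset[OF inj_on_image_Pow[OF inj_on_block_value]])
  moreover have "(`) ?w ` quotient_edges j E ?\<rho> \<subseteq> (\<Union>i\<in>{1..j}. (`) (b i) ` E)"
  proof clarify
    fix e assume "e \<in> quotient_edges j E ?\<rho>"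
    then obtain B C i l m where e: "e = {B, C}" "B \<in> ?\<rho>" "C \<in> ?\<rho>" "i \<in> {1..j}"
        "(i, l) \<in> B" "(i, m) \<in> C" "{l, m} \<in> E"
      unfolding quotient_edges_def by blast
    have "?w ` e = b i ` {l, m}"
      using block_value_eq[OF e(2,5)] block_value_eq[OF e(3,6)] e(1) by simp
    with e show "?w ` e \<in> (\<Union>i\<in>{1..j}. (`) (b i) ` E)" by blast
  qed
  ultimately show ?thesis
    using \<open>finite E\<close> by (intro card_inj_on_le) auto
qed

text \<open>A family with kernel \<open>\<rho>\<close> is determined by one value per block.
  Distinctness of these values is discarded, which gives a power instead of a falling
  factorial.\<close>

lemma card_kernel_fibre_le:
  fixes W :: "'b set"
  assumes "finite W"
  shows "card {b \<in> {1..j} \<rightarrow>\<^sub>E ({1..k} \<rightarrow>\<^sub>E W). kernel_partition (grid j k) (case_prod b) = \<rho>}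
    \<le> card W ^ card \<rho>"
proof (cases "partition_on (grid j k) \<rho>")
  case True
  let ?L = "{b \<in> {1..j} \<rightarrow>\<^sub>E ({1..k} \<rightarrow>\<^sub>E W). kernel_partition (grid j k) (case_prod b) = \<rho>}"
  let ?\<Phi> = "\<lambda>b. \<lambda>P\<in>\<rho>. block_value (case_prod b) P"
  have fin: "finite \<rho>"
    using finite_elements[OF finite_grid True] .
  have "inj_on ?\<Phi> ?L"
  proof (rule inj_onI)
    fix b b' assume b: "b \<in> ?L" and b': "b' \<in> ?L" and eq: "?\<Phi> b = ?\<Phi> b'"
    have "b i l = b' i l" if "i \<in> {1..j}" "l \<in> {1..k}" for i l
    proof -
      have "(i, l) \<in> grid j k" using that by (simp add: grid_def)
      then obtain P where P: "P \<in> \<rho>" "(i, l) \<in> P"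
        using True unfolding partition_on_def by blast
      have "b i l = ?\<Phi> b P"
        using P b block_value_eq[of P "grid j k" "case_prod b" "(i, l)"] by simp
      also have "\<dots> = b' i l"
        unfolding eq using P b' block_value_eq[of P "grid j k" "case_prod b'" "(i, l)"] by simp
      finally show ?thesis .
    qed
    then have "b i = b' i" if "i \<in> {1..j}" for i
      using that PiE_mem[of b _ "\<lambda>_. {1..k} \<rightarrow>\<^sub>E W" i] PiE_mem[of b' _ "\<lambda>_. {1..k} \<rightarrow>\<^sub>E W" i] b b'
      by (intro PiE_ext[of "b i" "{1..k}" "\<lambda>_. W" "b' i"]) blast+
    then show "b = b'"
      using b b' by (intro PiE_ext[of b "{1..j}" "\<lambda>_. {1..k} \<rightarrow>\<^sub>E W" b']) blast+
  qed
  moreover have "?\<Phi> ` ?L \<subseteq> \<rho> \<rightarrow>\<^sub>E W"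
  proof (rule image_subsetI)
    fix b assume "b \<in> ?L"
    then have b: "b \<in> {1..j} \<rightarrow>\<^sub>E ({1..k} \<rightarrow>\<^sub>E W)"
      and \<rho>: "\<rho> = kernel_partition (grid j k) (case_prod b)"
      by auto
    show "?\<Phi> b \<in> \<rho> \<rightarrow>\<^sub>E W"
    proof (rule restrict_PiE_iff[THEN iffD2], rule ballI)
      fix P assume P: "P \<in> \<rho>"
      then obtain i l where il: "(i, l) \<in> P" "i \<in> {1..j}" "l \<in> {1..k}"
        using True unfolding partition_on_def grid_def by (metis UnionI all_not_in_conv mem_Sigma_iff surj_pair)
      then have "block_value (case_prod b) P = b i l"
        using P block_value_eq[of P "grid j k" "case_prod b" "(i, l)"] \<rho> by simp
      moreover have "b i l \<in> W"
        using b il by (meson PiE_mem)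
      ultimately show "block_value (case_prod b) P \<in> W" by simp
    qed
  qed
  ultimately have "card ?L \<le> card (\<rho> \<rightarrow>\<^sub>E W)"
    using fin assms by (intro card_inj_on_le[of ?\<Phi>] finite_PiE)
  then show ?thesis
    using fin by (simp add: card_PiE)
next
  case False
  then have empty: "{b \<in> {1..j} \<rightarrow>\<^sub>E ({1..k} \<rightarrow>\<^sub>E W). kernel_partition (grid j k) (case_prod b) = \<rho>} = {}"
    using partition_on_kernel_partition by blast
  show ?thesis unfolding empty by simp
qed


section \<open>The cumulant bound\<close>

lemma doubleton_in_pair_edge:
  assumes "a \<in> {1..n}" "b \<in> {1..n}" "a \<noteq> b"
  shows "{a, b} \<in> pair_edge ` index_pairs n"
proof (cases "a < b")
  case True
  then have "(a, b) \<in> index_pairs n" using assms by (simp add: index_pairs_def)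
  then show ?thesis by (force simp: pair_edge_def)
next
  case False
  then have "(b, a) \<in> index_pairs n" using assms by (simp add: index_pairs_def)
  then show ?thesis by (force simp: pair_edge_def)
qed

lemma image_edges_subset:
  assumes "simple_graph {1..k} E" "\<beta> \<in> {1..k} \<rightarrow>\<^sub>E {1..n}" "inj_on \<beta> {1..k}"
  shows "(`) \<beta> ` E \<subseteq> pair_edge ` index_pairs n"
proof (rule image_subsetI)
  fix e assume "e \<in> E"
  then have e: "e \<subseteq> {1..k}" "card e = 2"
    using assms(1) by (auto simp: simple_graph_def)
  then obtain l m where lm: "e = {l, m}" "l \<noteq> m"
    by (auto simp: card_2_iff)
  then have "\<beta> l \<noteq> \<beta> m"
    using assms(3) e(1) by (auto dest: inj_onD)
  moreover have "\<beta> l \<in> {1..n}" "\<beta> m \<in> {1..n}"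
    using assms(2) e(1) lm by (auto dest: PiE_mem)
  ultimately show "\<beta> ` e \<in> pair_edge ` index_pairs n"
    using doubleton_in_pair_edge lm by simp
qed

context binomial_rcm
begin

text \<open>The surviving tuples are grouped by the number \<open>r\<close> of blocks of their
  kernel partition; this produces the sum over \<open>r\<close>.\<close>

lemma abs_cumulant_copies_le:
  assumes graph: "simple_graph {1..k} E" and k: "1 \<le> k" and j: "1 \<le> j"
  shows "\<bar>cumulant M j (\<lambda>\<omega>. copies k E n (rcm_edges n H p X Y \<omega>))\<bar>
    \<le> real j ^ (j - 1) / real (card (automorphisms {1..k} E)) ^ j *
       (\<Sum>r = k..1 + (k - 1) * j.
          real (card (conn_nonflat j k r)) * real n ^ r * p ^ min_edges E j k r)"
proof -
  define B where "B = {\<beta> \<in> {1..k} \<rightarrow>\<^sub>E {1..n}. inj_on \<beta> {1..k}}"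
  define c where "c = 1 / real (card (automorphisms {1..k} E))"
  define F where "F \<omega> = rcm_edges n H p X Y \<omega>" for \<omega>
  define D :: "(nat \<Rightarrow> nat) \<Rightarrow> nat set set" where "D \<beta> = (`) \<beta> ` E" for \<beta>
  \<comment> \<open>The factor \<open>c = 1/a(G)\<close> is kept inside each summand and emerges as
    \<open>c ^ j\<close>.\<close>
  define f where "f \<beta> \<omega> = c * of_bool (D \<beta> \<subseteq> F \<omega>)" for \<beta> \<omega>
  define J where "J = {1..j}"
  define m where "m b T = expectation (\<lambda>\<omega>. \<Prod>i\<in>T. f (b i) \<omega>)" for b and T :: "nat set"
  define ker where "ker b = kernel_partition (grid j k) (case_prod b)" for b :: "nat \<Rightarrow> nat \<Rightarrow> nat"
  define h where "h r = p ^ min_edges E j k r" for r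
  have c0: "0 \<le> c" by (simp add: c_def)
  have p: "0 < p" "p < 1" by (rule p_range)+
  have "E \<subseteq> Pow {1..k}" and E: "\<And>e. e \<in> E \<Longrightarrow> e \<subseteq> {1..k}"
    using graph by (auto simp: simple_graph_def)
  then have fE: "finite E"
    by (blast intro: finite_subset)
  have fD: "finite (D \<beta>)" for \<beta>
    using fE by (simp add: D_def)
  have fB: "finite B"
    unfolding B_def by (rule finite_subset[of _ "{1..k} \<rightarrow>\<^sub>E {1..n}"]) (auto intro: finite_PiE)
  have D_sub: "D \<beta> \<subseteq> pair_edge ` index_pairs n" if "\<beta> \<in> B" for \<beta>
    using image_edges_subset[OF graph] that by (auto simp: B_def D_def)
  have D_V: "\<Union>(D \<beta>) \<subseteq> \<beta> ` {1..k}" for \<beta>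
    using E by (auto simp: D_def)
  have simple: "simple_function M (f \<beta>)" if "\<beta> \<in> B" for \<beta>
  proof (rule simple_function_borel_measurable)
    have [measurable]: "Measurable.pred M (\<lambda>\<omega>. D \<beta> \<subseteq> F \<omega>)"
      unfolding F_def by (rule measurable_edges[OF D_sub[OF that]])
    show "f \<beta> \<in> borel_measurable M"
      unfolding f_def by measurable
    show "finite (f \<beta> ` space M)"
      by (rule finite_subset[of _ "{0, c}"]) (auto simp: f_def)
  qed
  have copies_eq: "copies k E n (F \<omega>) = (\<Sum>\<beta>\<in>B. f \<beta> \<omega>)" for \<omega>
  proof -
    have "(\<Prod>e\<in>E. of_bool (\<beta> ` e \<in> F \<omega>) :: real) = of_bool (D \<beta> \<subseteq> F \<omega>)" for \<beta>
      using fE by (simp add: prod_of_bool D_def image_subset_iff)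
    then show ?thesis
      by (simp add: copies_def B_def f_def c_def sum_distrib_left)
  qed
  \<comment> \<open>The product of indicators is the indicator of the union, so an edge shared by
    several copies counts once.\<close>
  have m_eq: "m b T = c ^ card T * expectation (\<lambda>\<omega>. of_bool ((\<Union>i\<in>T. D (b i)) \<subseteq> F \<omega>))"
    if "finite T" for b T
  proof -
    have "(\<Prod>i\<in>T. f (b i) \<omega>) = c ^ card T * of_bool ((\<Union>i\<in>T. D (b i)) \<subseteq> F \<omega>)" for \<omega>
      using that by (simp add: f_def prod.distrib prod_of_bool UN_subset_iff)
    then show ?thesis by (simp add: m_def)
  qed
  have UD_sub: "(\<Union>i\<in>T. D (b i)) \<subseteq> pair_edge ` index_pairs n" if "b \<in> J \<rightarrow>\<^sub>E B" "T \<subseteq> J" for b T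
    using D_sub PiE_mem[OF that(1)] that(2) by blast

  have bound: "\<bar>joint_cumulant (m b) J\<bar> \<le> real j ^ (j - 1) * (c ^ j * p ^ card (\<Union>i\<in>J. D (b i)))"
    if b: "b \<in> J \<rightarrow>\<^sub>E B" for b
  proof -
    \<comment> \<open>Supermultiplicative because the size of a union is subadditive and
      \<open>p < 1\<close>.\<close>
    define w where "w T = c ^ card T * p ^ card (\<Union>i\<in>T. D (b i))" for T
    have "\<bar>joint_cumulant (m b) J\<bar> \<le> real (card J) ^ (card J - 1) * w J"
    proof (rule abs_joint_cumulant_le)
      fix T assume T: "T \<subseteq> J"
      then have fT: "finite T" by (rule finite_subset) (simp add: J_def)
      have "0 \<le> expectation (\<lambda>\<omega>. of_bool ((\<Union>i\<in>T. D (b i)) \<subseteq> F \<omega>) :: real)"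
        by (intro Bochner_Integration.integral_nonneg) simp
      moreover have "expectation (\<lambda>\<omega>. of_bool ((\<Union>i\<in>T. D (b i)) \<subseteq> F \<omega>)) \<le> p ^ card (\<Union>i\<in>T. D (b i))"
        unfolding F_def by (rule prob_edges_le[OF UD_sub[OF b T]])
      ultimately show "\<bar>m b T\<bar> \<le> w T"
        unfolding m_eq[OF fT] w_def abs_mult using c0 by (intro mult_mono) auto
    next
      fix T R assume TR: "T \<subseteq> R" "R \<subseteq> J"
      have fR: "finite R" using TR(2) by (rule finite_subset) (simp add: J_def)
      have "(\<Union>i\<in>R. D (b i)) = (\<Union>i\<in>T. D (b i)) \<union> (\<Union>i\<in>R - T. D (b i))"
        using TR by auto
      then have "card (\<Union>i\<in>R. D (b i)) \<le> card (\<Union>i\<in>T. D (b i)) + card (\<Union>i\<in>R - T. D (b i))"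
        by (simp add: card_Un_le)
      then have "p ^ (card (\<Union>i\<in>T. D (b i)) + card (\<Union>i\<in>R - T. D (b i))) \<le> p ^ card (\<Union>i\<in>R. D (b i))"
        using p by (intro power_decreasing) auto
      moreover have "card T + card (R - T) = card R"
        using TR fR by (simp add: card_Diff_subset finite_subset card_mono)
      then have "w T * w (R - T) = c ^ card R * p ^ (card (\<Union>i\<in>T. D (b i)) + card (\<Union>i\<in>R - T. D (b i)))"
        by (simp add: w_def power_add flip: \<open>card T + card (R - T) = card R\<close>)
      ultimately show "w T * w (R - T) \<le> w R"
        using c0 by (simp add: w_def mult_left_mono)
    qed (use j in \<open>auto simp: J_def\<close>)
    then show ?thesis by (simp add: w_def J_def)
  qed

  define L where "L = {b \<in> J \<rightarrow>\<^sub>E B. linked_family J (\<lambda>i. b i ` {1..k})}"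
  have fJB: "finite (J \<rightarrow>\<^sub>E B)"
    using fB by (auto simp: J_def intro: finite_PiE)
  then have fL: "finite L" by (simp add: L_def)
  have unlinked: "joint_cumulant (m b) J = 0" if b: "b \<in> (J \<rightarrow>\<^sub>E B) - L" for b
  proof -
    \<comment> \<open>The cut separates the vertices, hence the edge sets on its two sides are
      vertex-disjoint and the moments factorise.\<close>
    obtain A where A: "A \<subseteq> J" "A \<noteq> {}" "A \<noteq> J"
      and disj: "(\<Union>i\<in>A. b i ` {1..k}) \<inter> (\<Union>i\<in>J - A. b i ` {1..k}) = {}"
      using b unfolding L_def linked_family_def by blast
    have bB: "b \<in> J \<rightarrow>\<^sub>E B" using b by simp
    show ?thesis
    proof (rule joint_cumulant_eq_0[of J "m b" A "J - A"])
      fix T assume T: "T \<subseteq> J"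
      then have fT: "finite T" by (rule finite_subset) (simp add: J_def)
      let ?D1 = "\<Union>i\<in>T \<inter> A. D (b i)" and ?D2 = "\<Union>i\<in>T \<inter> (J - A). D (b i)"
      have "\<Union>?D1 \<subseteq> (\<Union>i\<in>A. b i ` {1..k})" "\<Union>?D2 \<subseteq> (\<Union>i\<in>J - A. b i ` {1..k})"
        using D_V by blast+
      then have "\<Union>?D1 \<inter> \<Union>?D2 = {}"
        using disj by blast
      moreover have "?D1 \<subseteq> pair_edge ` index_pairs n" "?D2 \<subseteq> pair_edge ` index_pairs n"
        using T by (intro UD_sub[OF bB]; blast)+
      moreover have "(\<Union>i\<in>T. D (b i)) = ?D1 \<union> ?D2"
        using T by blast
      moreover have "card T = card (T \<inter> A) + card (T \<inter> (J - A))"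
      proof -
        have "T = (T \<inter> A) \<union> (T \<inter> (J - A))" using T by blast
        then show ?thesis
          using fT by (subst card_Un_disjoint[symmetric]) auto
      qed
      ultimately show "m b T = m b (T \<inter> A) * m b (T \<inter> (J - A))"
        using fT by (simp only: m_eq prob_edges_Un F_def) (simp add: m_eq F_def power_add)
    qed (use A in \<open>auto simp: J_def m_def prob_space\<close>)
  qed

  have linked: "ker b \<in> conn_nonflat j k (card (ker b))" "card (ker b) \<in> {k..1 + (k - 1) * j}"
    if "b \<in> L" for b
  proof -
    have bJ: "b \<in> {1..j} \<rightarrow>\<^sub>E B"
      using that by (simp add: L_def J_def)
    have inj: "inj_on (b i) {1..k}" if "i \<in> {1..j}" for i
      using PiE_mem[OF bJ that] by (simp add: B_def)
    have link: "linked_family {1..j} (\<lambda>i. b i ` {1..k})"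
      using that by (simp add: L_def J_def)
    show "ker b \<in> conn_nonflat j k (card (ker b))"
      unfolding conn_nonflat_def ker_def
      by (intro CollectI conjI refl partition_on_kernel_partition
          non_flat_kernel_partition[OF k] inj connected_kernel_partition[OF j k link])
    have "case_prod b ` grid j k = (\<Union>i\<in>{1..j}. b i ` {1..k})"
      by (force simp: grid_def)
    then have card_ker: "card (ker b) = card (\<Union>i\<in>{1..j}. b i ` {1..k})"
      by (simp add: ker_def card_kernel_partition)
    \<comment> \<open>Blocks correspond to vertices of the union, and a single copy already has
      \<open>k\<close> of them: the lower limit of the sum.\<close>
    have "card (b 1 ` {1..k}) = k"
      using inj[of 1] j by (simp add: card_image)
    moreover have "card (b 1 ` {1..k}) \<le> card (\<Union>i\<in>{1..j}. b i ` {1..k})"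
      using j by (intro card_mono) auto
    moreover have "card (\<Union>i\<in>{1..j}. b i ` {1..k}) \<le> 1 + (k - 1) * card {1..j}"
      using j inj link by (intro card_Union_linked_family_le) (auto simp: card_image)
    ultimately show "card (ker b) \<in> {k..1 + (k - 1) * j}"
      by (simp add: card_ker)
  qed

  have D_card: "p ^ card (\<Union>i\<in>J. D (b i)) \<le> h (card (ker b))" if "b \<in> L" for b
  proof -
    \<comment> \<open>Here \<open>ker b\<close> itself belongs to the set minimised over, so the
      minimum is a genuine one.\<close>
    have "min_edges E j k (card (ker b)) \<le> card (quotient_edges j E (ker b))"
      unfolding min_edges_def using linked(1)[OF that] finite_conn_nonflat by (intro Min_le) auto
    also have "\<dots> \<le> card (\<Union>i\<in>J. D (b i))"
      unfolding ker_def J_def D_def by (rule card_quotient_edges_le[OF E])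
    finally show ?thesis
      unfolding h_def using p by (intro power_decreasing) auto
  qed

  have count: "card {b \<in> L. card (ker b) = r} \<le> card (conn_nonflat j k r) * n ^ r" for r
  proof -
    \<comment> \<open>Injectivity and linkedness are dropped here; each is already reflected in
      \<open>\<rho>\<close> being non-flat and connected.\<close>
    let ?K = "\<lambda>\<rho>. {b \<in> {1..j} \<rightarrow>\<^sub>E ({1..k} \<rightarrow>\<^sub>E {1..n}). ker b = \<rho>}"
    have "J \<rightarrow>\<^sub>E B \<subseteq> {1..j} \<rightarrow>\<^sub>E ({1..k} \<rightarrow>\<^sub>E {1..n})"
      unfolding J_def by (rule PiE_mono) (auto simp: B_def)
    then have "{b \<in> L. card (ker b) = r} \<subseteq> (\<Union>\<rho>\<in>conn_nonflat j k r. ?K \<rho>)"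
      using linked(1) by (auto simp: L_def)
    then have "card {b \<in> L. card (ker b) = r} \<le> card (\<Union>\<rho>\<in>conn_nonflat j k r. ?K \<rho>)"
      by (intro card_mono) (auto simp: finite_conn_nonflat intro!: finite_PiE)
    also have "\<dots> \<le> (\<Sum>\<rho>\<in>conn_nonflat j k r. card (?K \<rho>))"
      by (rule card_UN_le[OF finite_conn_nonflat])
    also have "\<dots> \<le> (\<Sum>\<rho>\<in>conn_nonflat j k r. n ^ r)"
    proof (rule sum_mono)
      fix \<rho> assume "\<rho> \<in> conn_nonflat j k r"
      then have "card \<rho> = r" by (simp add: conn_nonflat_def)
      then show "card (?K \<rho>) \<le> n ^ r"
        using card_kernel_fibre_le[of "{1..n}" j k \<rho>] by (simp add: ker_def)
    qed
    finally show ?thesis by simp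
  qed

  have "(\<Sum>b\<in>L. h (card (ker b)))
      = (\<Sum>r = k..1 + (k - 1) * j. \<Sum>b | b \<in> L \<and> card (ker b) = r. h (card (ker b)))"
    by (rule sum.group[symmetric, OF fL finite_atLeastAtMost]) (rule image_subsetI[OF linked(2)])
  also have "\<dots> = (\<Sum>r = k..1 + (k - 1) * j. real (card {b \<in> L. card (ker b) = r}) * h r)"
    by simp
  also have "\<dots> \<le> (\<Sum>r = k..1 + (k - 1) * j. real (card (conn_nonflat j k r)) * real n ^ r * h r)"
  proof (intro sum_mono mult_right_mono)
    fix r
    show "real (card {b \<in> L. card (ker b) = r}) \<le> real (card (conn_nonflat j k r)) * real n ^ r"
      using count[of r] by (simp flip: of_nat_le_iff[where 'a = real])
  qed (use p in \<open>auto simp: h_def\<close>)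
  finally have sum_le: "(\<Sum>b\<in>L. h (card (ker b)))
      \<le> (\<Sum>r = k..1 + (k - 1) * j. real (card (conn_nonflat j k r)) * real n ^ r * h r)" .

  have "cumulant M j (\<lambda>\<omega>. copies k E n (F \<omega>)) = (\<Sum>b\<in>J \<rightarrow>\<^sub>E B. joint_cumulant (m b) J)"
    using cumulant_sum[OF fB simple, where S = J] j by (simp add: copies_eq m_def[abs_def] J_def)
  also have "\<dots> = (\<Sum>b\<in>L. joint_cumulant (m b) J)"
    using unlinked fJB by (intro sum.mono_neutral_right) (auto simp: L_def)
  also have "\<bar>\<dots>\<bar> \<le> (\<Sum>b\<in>L. real j ^ (j - 1) * c ^ j * h (card (ker b)))"
  proof (rule order.trans[OF sum_abs sum_mono])
    fix b assume b: "b \<in> L"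
    then have "\<bar>joint_cumulant (m b) J\<bar> \<le> real j ^ (j - 1) * (c ^ j * p ^ card (\<Union>i\<in>J. D (b i)))"
      by (intro bound) (simp add: L_def)
    also have "\<dots> \<le> real j ^ (j - 1) * (c ^ j * h (card (ker b)))"
      using D_card[OF b] c0 by (intro mult_left_mono) auto
    finally show "\<bar>joint_cumulant (m b) J\<bar> \<le> real j ^ (j - 1) * c ^ j * h (card (ker b))"
      by (simp add: mult.assoc)
  qed
  also have "\<dots> = real j ^ (j - 1) * c ^ j * (\<Sum>b\<in>L. h (card (ker b)))"
    by (simp add: sum_distrib_left)
  also have "\<dots> \<le> real j ^ (j - 1) * c ^ j *
      (\<Sum>r = k..1 + (k - 1) * j. real (card (conn_nonflat j k r)) * real n ^ r * h r)"
    using sum_le c0 by (intro mult_left_mono) auto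
  finally show ?thesis
    by (simp add: F_def h_def c_def power_divide)
qed

end

theorem theorem5p2:
  fixes M :: "'w measure"
    and \<mu> :: "(real ^ 'd) measure"
    and H :: "real ^ 'd \<Rightarrow> real ^ 'd \<Rightarrow> real"
    and X :: "nat \<Rightarrow> 'w \<Rightarrow> real ^ 'd"
    and Y :: "nat \<times> nat \<Rightarrow> 'w \<Rightarrow> real"
    and p :: real
    and n k j :: nat
    and E :: "nat set set"
  assumes "binomial_rcm M n \<mu> H p X Y"
    and "k \<ge> 2"
    and "connected_graph {1..k} E"
    and "j \<ge> 2"
  shows "\<bar>cumulant M j (\<lambda>\<omega>. copies k E n (rcm_edges n H p X Y \<omega>))\<bar>
    \<le> real j ^ (j - 1) / real (card (automorphisms {1..k} E)) ^ j *
       (\<Sum>r = k..1 + (k - 1) * j.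
          real (card (conn_nonflat j k r)) * real n ^ r * p ^ min_edges E j k r)"
  using assms by (intro binomial_rcm.abs_cumulant_copies_le) (auto simp: connected_graph_def)

end
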